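(* There are algorithms (that resample) on $n$ elements that: (i) solve PARTITION or SELECT in the erasure model with probability $1$ with expected query complexity $O(n/\gamma)$; (ii) solve PARTITION or SELECT in the erasure model with probability $1-1/\mathrm{poly}(n)$ with query complexity $O(n\log n/\gamma)$ and round complexity $4$; (iii) solve PARTITION or SELECT in the noisy model with probability $1-1/\mathrm{poly}(n)$ with query complexity $O(n\log n/\gamma^2)$ and round complexity $4$.
   Context: The input is a set of $n$ elements with an unknown total order, in uniformly random order. PARTITION: split the elements into accepted and rejected so that every element above the median is accepted and every element below it is rejected. SELECT: output the median. Algorithms access the order only through pairwise comparison queries. Query complexity is the total number of comparisons; round complexity is the number of adaptive rounds (within a round all queries are chosen before any answer of that round is seen). An algorithm resamples if it may query the same pair more than once. Erasure model with parameter $\gamma$: each comparison independently returns the correct answer with probability $\gamma$ and the symbol $\bot$ with probability $1-\gamma$. Noisy model with parameter $\gamma$: each comparison independently returns the correct answer with probability $1/2+\gamma/2$ and the incorrect one with probability $1/2-\gamma/2$. $1/\mathrm{poly}(n)$ denotes an inverse polynomial in $n$ of any prescribed fixed degree, the constants in $O(\cdot)$ depending on that degree. *)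

theory Defs
  imports "HOL-Probability.Probability" "HOL-Combinatorics.Permutations"
begin

text \<open>
  The elements are \<open>0, \<dots>, n - 1\<close>. A total order on them is given by its rank function, a
  permutation \<open>\<sigma>\<close> of \<open>{..<n}\<close>: element \<open>x\<close> lies below element \<open>y\<close> iff \<open>\<sigma> x < \<sigma> y\<close>, and
  \<open>\<sigma> x\<close> is the number of elements below \<open>x\<close>.
\<close>

definition rankings :: "nat \<Rightarrow> (nat \<Rightarrow> nat) set" where
  "rankings n = {\<sigma>. \<sigma> permutes {..<n}}"

text \<open>For even \<open>n\<close> this is the lower median, the element of rank \<open>\<lceil>n/2\<rceil>\<close> counted from \<open>1\<close>.\<close>

definition is_median :: "nat \<Rightarrow> (nat \<Rightarrow> nat) \<Rightarrow> nat \<Rightarrow> bool" where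
  "is_median n \<sigma> m \<longleftrightarrow> m < n \<and> \<sigma> m = (n - 1) div 2"

text \<open>
  A solution of PARTITION is the set \<open>S\<close> of accepted elements, the other elements being
  rejected. The median itself may go either way.
\<close>

definition partition_correct :: "nat \<Rightarrow> (nat \<Rightarrow> nat) \<Rightarrow> nat set \<Rightarrow> bool" where
  "partition_correct n \<sigma> S \<longleftrightarrow> S \<subseteq> {..<n} \<and>
     (\<forall>m. is_median n \<sigma> m \<longrightarrow>
        (\<forall>x<n. (\<sigma> m < \<sigma> x \<longrightarrow> x \<in> S) \<and> (\<sigma> x < \<sigma> m \<longrightarrow> x \<notin> S)))"

definition select_correct :: "nat \<Rightarrow> (nat \<Rightarrow> nat) \<Rightarrow> nat \<Rightarrow> bool" where
  "select_correct n \<sigma> x \<longleftrightarrow> is_median n \<sigma> x"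

text \<open>
  An algorithm maps the answers received so far, grouped by round (oldest round first), either
  to the list of all queries of the next round or to its output. The past queries need not be
  part of the history, as they are determined by the past answers. A pair may occur repeatedly,
  both within a round and in different rounds.
\<close>

datatype 'o action = Ask "(nat \<times> nat) list" | Output 'o

type_synonym ('r, 'o) algorithm = "'r list list \<Rightarrow> 'o action"

definition valid_algorithm :: "nat \<Rightarrow> ('r, 'o) algorithm \<Rightarrow> bool" where
  "valid_algorithm n A \<longleftrightarrow>
     (\<forall>h qs. A h = Ask qs \<longrightarrow> (\<forall>(x, y) \<in> set qs. x < n \<and> y < n \<and> x \<noteq> y))"

text \<open>
  The answer to a query depends on a noise bit, telling whether the comparison works properly,
  and on the correct answer.
\<close>

definition erasure_answer :: "bool \<Rightarrow> bool \<Rightarrow> bool option" where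
  "erasure_answer ok b = (if ok then Some b else None)"

definition noisy_answer :: "bool \<Rightarrow> bool \<Rightarrow> bool" where
  "noisy_answer ok b = (if ok then b else \<not> b)"

text \<open>
  The history after \<open>k\<close> rounds, which no longer changes once the algorithm has produced an
  output. The \<open>t\<close>-th query overall consumes the noise bit \<open>\<omega> t\<close>, so every query, including a
  repeated one, is answered with fresh noise.
\<close>

primrec history ::
  "(bool \<Rightarrow> bool \<Rightarrow> 'r) \<Rightarrow> ('r, 'o) algorithm \<Rightarrow> (nat \<Rightarrow> nat) \<Rightarrow> (nat \<Rightarrow> bool) \<Rightarrow> nat \<Rightarrow> 'r list list"
where
  "history ans A \<sigma> \<omega> 0 = []"
| "history ans A \<sigma> \<omega> (Suc k) =
     (let h = history ans A \<sigma> \<omega> k; t = length (concat h) in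
      case A h of
        Output y \<Rightarrow> h
      | Ask qs \<Rightarrow>
          h @ [map (\<lambda>i. ans (\<omega> (t + i)) (\<sigma> (fst (qs ! i)) < \<sigma> (snd (qs ! i)))) [0..<length qs]])"

definition outputs ::
  "(bool \<Rightarrow> bool \<Rightarrow> 'r) \<Rightarrow> ('r, 'o) algorithm \<Rightarrow> (nat \<Rightarrow> nat) \<Rightarrow> (nat \<Rightarrow> bool) \<Rightarrow> 'o \<Rightarrow> bool"
where
  "outputs ans A \<sigma> \<omega> y \<longleftrightarrow> (\<exists>k. A (history ans A \<sigma> \<omega> k) = Output y)"

text \<open>
  A run that never produces an output has infinitely many rounds. Rounds without queries
  are counted as well.
\<close>

definition num_queries ::
  "(bool \<Rightarrow> bool \<Rightarrow> 'r) \<Rightarrow> ('r, 'o) algorithm \<Rightarrow> (nat \<Rightarrow> nat) \<Rightarrow> (nat \<Rightarrow> bool) \<Rightarrow> ennreal"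
where
  "num_queries ans A \<sigma> \<omega> = (SUP k. of_nat (length (concat (history ans A \<sigma> \<omega> k))))"

definition num_rounds ::
  "(bool \<Rightarrow> bool \<Rightarrow> 'r) \<Rightarrow> ('r, 'o) algorithm \<Rightarrow> (nat \<Rightarrow> nat) \<Rightarrow> (nat \<Rightarrow> bool) \<Rightarrow> ennreal"
where
  "num_rounds ans A \<sigma> \<omega> = (SUP k. of_nat (length (history ans A \<sigma> \<omega> k)))"

text \<open>A uniformly random order together with independent noise bits that are true with
  probability \<open>p\<close>.\<close>

definition run_space :: "nat \<Rightarrow> real \<Rightarrow> ((nat \<Rightarrow> nat) \<times> (nat \<Rightarrow> bool)) measure" where
  "run_space n p =
     uniform_count_measure (rankings n) \<Otimes>\<^sub>M (\<Pi>\<^sub>M t\<in>UNIV. measure_pmf (bernoulli_pmf p))"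

definition success_prob ::
  "nat \<Rightarrow> real \<Rightarrow> (bool \<Rightarrow> bool \<Rightarrow> 'r) \<Rightarrow> (nat \<Rightarrow> (nat \<Rightarrow> nat) \<Rightarrow> 'o \<Rightarrow> bool) \<Rightarrow>
   ('r, 'o) algorithm \<Rightarrow> real"
where
  "success_prob n p ans correct A =
     \<P>((\<sigma>, \<omega>) in run_space n p. \<exists>y. outputs ans A \<sigma> \<omega> y \<and> correct n \<sigma> y)"

definition expected_queries ::
  "nat \<Rightarrow> real \<Rightarrow> (bool \<Rightarrow> bool \<Rightarrow> 'r) \<Rightarrow> ('r, 'o) algorithm \<Rightarrow> ennreal"
where
  "expected_queries n p ans A = (\<integral>\<^sup>+(\<sigma>, \<omega>). num_queries ans A \<sigma> \<omega> \<partial>run_space n p)"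

definition queries_bounded ::
  "nat \<Rightarrow> (bool \<Rightarrow> bool \<Rightarrow> 'r) \<Rightarrow> ('r, 'o) algorithm \<Rightarrow> real \<Rightarrow> bool"
where
  "queries_bounded n ans A B \<longleftrightarrow>
     (\<forall>\<sigma>\<in>rankings n. \<forall>\<omega>. num_queries ans A \<sigma> \<omega> \<le> ennreal B)"

definition rounds_bounded ::
  "nat \<Rightarrow> (bool \<Rightarrow> bool \<Rightarrow> 'r) \<Rightarrow> ('r, 'o) algorithm \<Rightarrow> nat \<Rightarrow> bool"
where
  "rounds_bounded n ans A k \<longleftrightarrow>
     (\<forall>\<sigma>\<in>rankings n. \<forall>\<omega>. num_rounds ans A \<sigma> \<omega> \<le> of_nat k)"

lemma prob_space_run_space: "prob_space (run_space n p)"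
proof -
  have "finite (rankings n)" "rankings n \<noteq> {}"
    by (auto simp: rankings_def finite_permutations intro: permutes_id)
  then interpret U: prob_space "uniform_count_measure (rankings n)"
    by (rule prob_space_uniform_count_measure)
  interpret N: prob_space "\<Pi>\<^sub>M t\<in>(UNIV::nat set). measure_pmf (bernoulli_pmf p)"
    by (intro prob_space_PiM) (rule prob_space_measure_pmf)
  interpret P: pair_prob_space "uniform_count_measure (rankings n)"
    "\<Pi>\<^sub>M t\<in>(UNIV::nat set). measure_pmf (bernoulli_pmf p)" ..
  show ?thesis unfolding run_space_def by (rule P.prob_space_axioms)
qed

end

theory Submission imports Defs
begin

text \<open>
  The queries of a noiseless algorithm are chosen from the relation of all comparisons known so far.
  Four rounds with \<open>O(n)\<close> queries suffice for a random order, up to an error that is smaller than any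
  inverse polynomial. With \<open>k\<close> about \<open>n powr (1/20)\<close>, round 1 compares \<open>k^13\<close> elements with \<open>k^7\<close>
  of them and finds two pivots enclosing the median, about \<open>n / k^6\<close> ranks apart. Round 2 compares
  everything with the pivots. Round 3 compares all elements left between them with those of the first
  \<open>k^11\<close> elements that lie there, which leaves at most \<open>2 * n / k^10\<close> candidates. Round 4 compares all pairs of
  candidates. The probabilistic input is Hoeffding's inequality for sampling without replacement,
  which follows from the bound \<open>(|I| / n) ^ |T|\<close> on the probability that all elements of \<open>T\<close>
  have ranks in \<open>I\<close>.

  To tolerate noise in a fixed number of rounds, every query is repeated \<open>O(ln n / \<gamma>)\<close> or
  \<open>O(ln n / \<gamma>\<^sup>2)\<close> times. For expected cost \<open>O(n / \<gamma>)\<close> in the erasure model, the queries are asked one by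
  one until each is answered, so the cost is the waiting time for a number of heads that depends on
  the order only; if the median is not determined after four rounds, all pairs are compared.
\<close>

section \<open>Sampling without replacement\<close>

text \<open>Pivots and candidates depend on earlier answers, yet nothing is conditioned on them. The
  randomness of the order is confined to one property, \<open>good_ranking\<close>, whose failure is
  covered by fixed events: tails at every rank threshold, and rank windows that an initial segment
  of the elements misses. For an order with this property the run is analysed deterministically.

  The exponents balance deviations against costs. Among k^13 sampled elements, the number below a
  threshold deviates by k^7 with probability at most 2 exp(-2k), and k^7 sampled elements correspond
  to n / k^6 ranks. A window of that width holds about k of the first k^7 elements, and one of n /
  k^10 ranks about k of the first k^11, so it is missed with probability about exp(-k), or exp(-k/2)
  after rounding. The costs are k^20 \<le> n, then 2 n, then (24 n / k^6)(25 k^6), then (2 n /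
  k^10)^2, which is O(n) because n \<le> (2 k)^20.

  Decoding errors are bounded per block of noise bits, whatever query the block serves, so noise and
  order are treated separately.\<close>

definition rankings_in :: "nat \<Rightarrow> nat set \<Rightarrow> nat set \<Rightarrow> (nat \<Rightarrow> nat) set" where
  "rankings_in n T I = {\<sigma> \<in> rankings n. \<sigma> ` T \<subseteq> I}"

lemma finite_rankings [simp]: "finite (rankings n)"
  by (simp add: rankings_def finite_permutations)

lemma card_rankings: "card (rankings n) = fact n"
  unfolding rankings_def by (rule card_permutations) auto

lemma rankings_less_iff: "\<sigma> \<in> rankings n \<Longrightarrow> \<sigma> x < n \<longleftrightarrow> x < n"
  unfolding rankings_def using permutes_in_image[of \<sigma> "{..<n}" x] by auto

lemma rankings_inj: "\<sigma> \<in> rankings n \<Longrightarrow> \<sigma> x = \<sigma> y \<longleftrightarrow> x = y"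
  unfolding rankings_def using permutes_inj[of \<sigma> "{..<n}"] by (auto simp: inj_def)

lemma rankings_image: "\<sigma> \<in> rankings n \<Longrightarrow> \<sigma> ` {..<n} = {..<n}"
  unfolding rankings_def using permutes_image[of \<sigma> "{..<n}"] by auto

lemma card_rank_in:
  assumes "\<sigma> \<in> rankings n" "I \<subseteq> {..<n}"
  shows "card {x \<in> {..<n}. \<sigma> x \<in> I} = card I"
proof -
  have inj: "inj_on \<sigma> A" for A using assms(1) by (auto simp: inj_on_def rankings_inj)
  have "\<sigma> ` {x \<in> {..<n}. \<sigma> x \<in> I} = I"
    using rankings_image[OF assms(1)] assms(2) by (auto simp: image_iff)
  then show ?thesis using card_image[OF inj] by metis
qed

text \<open>Composing with the transposition of \<open>x\<close> and \<open>z\<close> is an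
  involution that acts trivially on \<open>T\<close> and exchanges the two sets.\<close>

lemma card_rankings_in_insert_swap:
  assumes "x < n" "z < n" "x \<notin> T" "z \<notin> T"
  shows "card (rankings_in n (insert x T) I) = card (rankings_in n (insert z T) I)"
proof (rule bij_betw_same_card[where f = "\<lambda>\<sigma>. \<sigma> \<circ> Transposition.transpose x z"])
  have p: "Transposition.transpose x z permutes {..<n}" using assms by (intro permutes_swap_id) auto
  have *: "\<sigma> \<circ> Transposition.transpose x z \<in> rankings_in n (insert v T) I"
    if "\<sigma> \<in> rankings_in n (insert u T) I" "{u, v} = {x, z}" for \<sigma> u v
  proof -
    have "\<sigma> \<circ> Transposition.transpose x z \<in> rankings n"
      using that(1) permutes_compose[OF p] by (auto simp: rankings_in_def rankings_def)
    moreover have "Transposition.transpose x z t = t" if "t \<in> T" for t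
      using assms that by (auto simp: Transposition.transpose_def)
    moreover have "Transposition.transpose x z v = u" using that(2) by (auto simp: Transposition.transpose_def doubleton_eq_iff)
    ultimately show ?thesis using that(1) by (auto simp: rankings_in_def)
  qed
  show "bij_betw (\<lambda>\<sigma>. \<sigma> \<circ> Transposition.transpose x z) (rankings_in n (insert x T) I) (rankings_in n (insert z T) I)"
  proof (rule bij_betw_byWitness[where f' = "\<lambda>\<sigma>. \<sigma> \<circ> Transposition.transpose x z"])
    show "(\<lambda>\<sigma>. \<sigma> \<circ> Transposition.transpose x z) ` rankings_in n (insert x T) I \<subseteq> rankings_in n (insert z T) I"
      using *[of _ x z] by blast
    show "(\<lambda>\<sigma>. \<sigma> \<circ> Transposition.transpose x z) ` rankings_in n (insert z T) I \<subseteq> rankings_in n (insert x T) I"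
      using *[of _ z x] by blast
  qed (simp_all add: comp_assoc)
qed

text \<open>Double counting of the pairs of a ranking in \<open>rankings_in n T I\<close> and an
  element \<open>z\<close> outside \<open>T\<close> with rank in \<open>I\<close>. By symmetry every
  \<open>z\<close> contributes the same; a fixed ranking has exactly \<open>card I - card T\<close>
  such \<open>z\<close>, since \<open>card I\<close> elements have ranks in \<open>I\<close> and
  those of \<open>T\<close> are among them.\<close>

lemma card_rankings_in_insert:
  assumes T: "T \<subseteq> {..<n}" "x < n" "x \<notin> T" and I: "I \<subseteq> {..<n}"
  shows "card (rankings_in n (insert x T) I) * (n - card T) = card (rankings_in n T I) * (card I - card T)"
proof -
  let ?A = "rankings_in n T I"
  have fT: "finite T" using T(1) finite_subset by blast
  have fA: "finite ?A" by (simp add: rankings_in_def)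
  have "card (rankings_in n (insert x T) I) * (n - card T) = (\<Sum>z\<in>{..<n} - T. card (rankings_in n (insert z T) I))"
  proof -
    have "(\<Sum>z\<in>{..<n} - T. card (rankings_in n (insert z T) I)) = (\<Sum>z\<in>{..<n} - T. card (rankings_in n (insert x T) I))"
      using T by (intro sum.cong refl card_rankings_in_insert_swap) auto
    then show ?thesis using T fT by (simp add: card_Diff_subset)
  qed
  also have "\<dots> = (\<Sum>z\<in>{..<n} - T. card {\<sigma> \<in> ?A. \<sigma> z \<in> I})"
    by (intro sum.cong arg_cong[where f = card]) (auto simp: rankings_in_def)
  also have "\<dots> = (\<Sum>z\<in>{..<n} - T. \<Sum>\<sigma>\<in>?A. if \<sigma> z \<in> I then 1 else 0)"
    using fA by (simp add: sum.If_cases Int_def)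
  also have "\<dots> = (\<Sum>\<sigma>\<in>?A. \<Sum>z\<in>{..<n} - T. if \<sigma> z \<in> I then 1 else 0)"
    by (rule sum.swap)
  also have "\<dots> = (\<Sum>\<sigma>\<in>?A. card I - card T)"
  proof (intro sum.cong refl)
    fix \<sigma> assume \<sigma>: "\<sigma> \<in> ?A"
    have "(\<Sum>z\<in>{..<n} - T. if \<sigma> z \<in> I then 1 else 0) = card ({x \<in> {..<n}. \<sigma> x \<in> I} - T)"
      by (simp add: sum.If_cases) (intro arg_cong[where f = card], auto)
    also have "\<dots> = card I - card T"
      using \<sigma> I T fT card_rank_in[of \<sigma> n I] by (subst card_Diff_subset) (auto simp: rankings_in_def)
    finally show "(\<Sum>z\<in>{..<n} - T. if \<sigma> z \<in> I then 1 else 0) = card I - card T" .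
  qed
  finally show ?thesis by simp
qed

text \<open>Adding an element to \<open>T\<close> multiplies the count by (|I| - |T|) / (n - |T|),
  which is at most |I| / n: ranks of \<open>I\<close> that are already taken make a further hit less
  likely.\<close>

lemma card_rankings_in_le:
  assumes "T \<subseteq> {..<n}" and I: "I \<subseteq> {..<n}" and "n > 0"
  shows "real (card (rankings_in n T I)) \<le> fact n * (card I / n) ^ card T"
proof -
  have "finite T" using assms(1) finite_subset by blast
  then show ?thesis using assms(1)
  proof (induction T rule: finite_induct)
    case empty
    have "rankings_in n {} I = rankings n" by (auto simp: rankings_in_def)
    then show ?case by (simp add: card_rankings)
  next
    case (insert x T)
    have lt: "card T < n"
    proof -
      have "T \<subset> {..<n}" using insert by auto
      then show ?thesis using psubset_card_mono[of "{..<n}" T] by simp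
    qed
    have In: "card I \<le> n" using card_mono[OF _ I] by simp
    have le: "real (card I - card T) * n \<le> real (n - card T) * card I"
    \<comment> \<open>If \<open>T\<close> is larger than \<open>I\<close>, the truncated difference
      is 0 and the bound is trivial.\<close>
    proof (cases "card T \<le> card I")
      case True
      have "card T * card I \<le> card T * n" using In by simp
      then have "(card I - card T) * n \<le> (n - card T) * card I"
        by (simp add: diff_mult_distrib diff_mult_distrib2 mult.commute diff_le_mono2)
      then show ?thesis unfolding of_nat_mult[symmetric] of_nat_le_iff .
    qed simp
    define a where "a = real (card (rankings_in n (insert x T) I))"
    define b where "b = real (card (rankings_in n T I))"
    have "a * (n - card T) = b * (card I - card T)"
      unfolding a_def b_def of_nat_mult[symmetric] of_nat_eq_iff
      by (rule card_rankings_in_insert) (use insert I in auto)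
    then have "a * n * real (n - card T) = b * (real (card I - card T) * n)" by (simp add: mult_ac)
    also have "\<dots> \<le> b * (real (n - card T) * card I)"
      by (intro mult_left_mono le) (simp add: b_def)
    finally have "(a * n) * real (n - card T) \<le> (b * card I) * real (n - card T)" by (simp add: mult_ac)
    then have "a * n \<le> b * card I" using lt by (subst (asm) mult_le_cancel_right) auto
    also have "\<dots> \<le> (fact n * (card I / n) ^ card T) * card I"
      using insert by (intro mult_right_mono) (auto simp: b_def)
    finally have "a \<le> (fact n * (card I / n) ^ card T) * card I / n"
      using assms(3) by (simp add: field_simps)
    then show ?case using insert by (simp add: a_def mult_ac)
  qed
qed

section \<open>Concentration of the number of sampled elements in a set of ranks\<close>

definition rank_count :: "(nat \<Rightarrow> nat) \<Rightarrow> nat set \<Rightarrow> nat set \<Rightarrow> nat" where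
  "rank_count \<sigma> T I = card {x \<in> T. \<sigma> x \<in> I}"

text \<open>Expanding the power over the subsets of \<open>T\<close> whose ranks all lie in
  \<open>I\<close> reduces the sum to \<open>card_rankings_in_le\<close>. With
  \<open>c = exp l - 1\<close> the right-hand side is \<open>fact n\<close> times the moment
  generating function of a binomial variable, so sampling without replacement obeys the Chernoff
  bounds of independent draws.\<close>

lemma rank_count_mgf:
  assumes "T \<subseteq> {..<n}" "I \<subseteq> {..<n}" "n > 0" "c \<ge> 0"
  shows "(\<Sum>\<sigma>\<in>rankings n. (1 + c) ^ rank_count \<sigma> T I) \<le> fact n * (1 + c * (card I / n)) ^ card T"
proof -
  have fT: "finite T" using assms(1) finite_subset by blast
  have "(1 + c) ^ rank_count \<sigma> T I = (\<Sum>U\<in>Pow T. if \<sigma> ` U \<subseteq> I then c ^ card U else 0)" for \<sigma>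
  proof -
    have "(1 + c) ^ rank_count \<sigma> T I = (\<Prod>x\<in>T. (if \<sigma> x \<in> I then c else 0) + 1)"
    proof -
      have "(\<Prod>x\<in>T. (if \<sigma> x \<in> I then c else 0) + 1) = (\<Prod>x\<in>T. if \<sigma> x \<in> I then c + 1 else 1)"
        by (rule prod.cong) auto
      then show ?thesis
        using fT by (simp add: prod.If_cases rank_count_def Int_def add.commute)
    qed
    also have "\<dots> = (\<Sum>U\<in>Pow T. (\<Prod>x\<in>U. if \<sigma> x \<in> I then c else 0) * (\<Prod>x\<in>T-U. 1))"
      by (rule prod_add[OF fT])
    also have "\<dots> = (\<Sum>U\<in>Pow T. if \<sigma> ` U \<subseteq> I then c ^ card U else 0)"
    proof (intro sum.cong refl)
      fix U assume "U \<in> Pow T"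
      then have "finite U" using fT finite_subset by auto
      then show "(\<Prod>x\<in>U. if \<sigma> x \<in> I then c else 0) * (\<Prod>x\<in>T-U. 1) = (if \<sigma> ` U \<subseteq> I then c ^ card U else 0)"
        by (auto simp: image_subset_iff prod_zero_iff intro!: prod_zero)
    qed
    finally show ?thesis .
  qed
  then have "(\<Sum>\<sigma>\<in>rankings n. (1 + c) ^ rank_count \<sigma> T I) =
      (\<Sum>U\<in>Pow T. \<Sum>\<sigma>\<in>rankings n. if \<sigma> ` U \<subseteq> I then c ^ card U else 0)"
    by (simp add: sum.swap[of _ "Pow T"])
  also have "\<dots> = (\<Sum>U\<in>Pow T. card (rankings_in n U I) * c ^ card U)"
    by (intro sum.cong refl) (simp add: sum.If_cases rankings_in_def Int_def)
  also have "\<dots> \<le> (\<Sum>U\<in>Pow T. (fact n * (card I / n) ^ card U) * c ^ card U)"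
    by (intro sum_mono mult_right_mono card_rankings_in_le) (use assms in auto)
  also have "\<dots> = fact n * (\<Sum>U\<in>Pow T. (\<Prod>x\<in>U. c * (card I / n)) * (\<Prod>x\<in>T-U. 1))"
    by (simp add: sum_distrib_left power_mult_distrib mult_ac power_divide)
  also have "(\<Sum>U\<in>Pow T. (\<Prod>x\<in>U. c * (card I / n)) * (\<Prod>x\<in>T-U. 1)) = (\<Prod>x\<in>T. c * (card I / n) + 1)"
    by (rule prod_add[OF fT, symmetric])
  finally show ?thesis by (simp add: add.commute)
qed

text \<open>Chernoff's method: Markov's inequality for the exponential of the count, the binomial
  generating function, and Hoeffding's lemma in the Bernoulli case,
  \<open>ln (1 + p * (exp l - 1)) \<le> l * p + l\<^sup>2 / 8\<close>.\<close>

lemma rank_count_upper_tail: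
  assumes T: "T \<subseteq> {..<n}" "T \<noteq> {}" and I: "I \<subseteq> {..<n}" and t: "t > 0"
  shows "real (card {\<sigma> \<in> rankings n. real (rank_count \<sigma> T I) \<ge> card T * card I / n + t})
     \<le> fact n * exp (- 2 * t\<^sup>2 / card T)" (is "real (card ?B) \<le> _")
proof -
  have fT: "finite T" using T(1) finite_subset by blast
  define s where "s = real (card T)"
  have s: "s > 0" using fT T by (simp add: s_def card_gt_0_iff)
  have n: "n > 0" using T by auto
  \<comment> \<open>This \<open>l\<close> minimises the final exponent
    \<open>s * l\<^sup>2 / 8 - l * t\<close>.\<close>
  define l where "l = 4 * t / s"
  define p where "p = real (card I) / n"
  have l: "l > 0" using s t by (simp add: l_def)
  have "real (card ?B) * exp (l * (s * p + t)) = (\<Sum>\<sigma>\<in>?B. exp (l * (s * p + t)))" by simp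
  also have "\<dots> \<le> (\<Sum>\<sigma>\<in>?B. (1 + (exp l - 1)) ^ rank_count \<sigma> T I)"
  proof (intro sum_mono)
    fix \<sigma> assume "\<sigma> \<in> ?B"
    then have "s * p + t \<le> rank_count \<sigma> T I" by (simp add: s_def p_def)
    then have "exp (l * (s * p + t)) \<le> exp (l * rank_count \<sigma> T I)" using l by simp
    also have "\<dots> = (1 + (exp l - 1)) ^ rank_count \<sigma> T I" by (simp add: exp_of_nat2_mult)
    finally show "exp (l * (s * p + t)) \<le> (1 + (exp l - 1)) ^ rank_count \<sigma> T I" .
  qed
  also have "\<dots> \<le> (\<Sum>\<sigma>\<in>rankings n. (1 + (exp l - 1)) ^ rank_count \<sigma> T I)"
    by (intro sum_mono2) auto
  also have "\<dots> \<le> fact n * (1 + (exp l - 1) * p) ^ card T"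
    unfolding p_def using l by (intro rank_count_mgf T I n) auto
  also have "\<dots> \<le> fact n * exp (l * p + l\<^sup>2 / 8) ^ card T"
  proof (intro mult_left_mono power_mono)
    have pos: "1 + p * (exp l - 1) > 0" using l by (intro add_pos_nonneg mult_nonneg_nonneg) (auto simp: p_def)
    have "ln (1 + p * (exp l - 1)) \<le> l * p + l\<^sup>2 / 8"
      using Hoeffdings_lemma_aux[of l p] l by (simp add: p_def)
    then show "1 + (exp l - 1) * p \<le> exp (l * p + l\<^sup>2 / 8)"
      using pos by (metis exp_le_cancel_iff exp_ln mult.commute)
  qed (use l in \<open>auto simp: p_def\<close>)
  also have "exp (l * p + l\<^sup>2 / 8) ^ card T = exp (s * (l * p + l\<^sup>2 / 8))"
    by (simp add: s_def exp_of_nat_mult)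
  finally have "real (card ?B) \<le> fact n * exp (s * (l * p + l\<^sup>2 / 8)) / exp (l * (s * p + t))"
    by (simp add: pos_le_divide_eq)
  also have "\<dots> = fact n * exp (s * (l * p + l\<^sup>2 / 8) - l * (s * p + t))" by (simp add: exp_diff)
  also have "s * (l * p + l\<^sup>2 / 8) - l * (s * p + t) = - 2 * t\<^sup>2 / s"
    using s by (simp add: l_def field_simps power2_eq_square)
  finally show ?thesis by (simp add: s_def)
qed

text \<open>The generating function bound has \<open>c \<ge> 0\<close> and so yields upper tails
  only; a deficit in \<open>I\<close> is therefore read as an excess in the complementary
  ranks.\<close>

lemma rank_count_lower_tail:
  assumes T: "T \<subseteq> {..<n}" "T \<noteq> {}" and I: "I \<subseteq> {..<n}" and t: "t > 0"
  shows "real (card {\<sigma> \<in> rankings n. real (rank_count \<sigma> T I) \<le> card T * card I / n - t})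
     \<le> fact n * exp (- 2 * t\<^sup>2 / card T)"
proof -
  have fT: "finite T" using T(1) finite_subset by blast
  have n: "n > 0" using T by auto
  have "rank_count \<sigma> T I + rank_count \<sigma> T ({..<n} - I) = card T" if "\<sigma> \<in> rankings n" for \<sigma>
  proof -
    have "{x \<in> T. \<sigma> x \<in> I} \<union> {x \<in> T. \<sigma> x \<in> {..<n} - I} = T"
      using T that rankings_less_iff by auto
    moreover have "card ({x \<in> T. \<sigma> x \<in> I} \<union> {x \<in> T. \<sigma> x \<in> {..<n} - I}) =
      card {x \<in> T. \<sigma> x \<in> I} + card {x \<in> T. \<sigma> x \<in> {..<n} - I}"
      using fT by (intro card_Un_disjoint) auto
    ultimately show ?thesis by (simp add: rank_count_def)
  qed
  then have eq: "real (rank_count \<sigma> T I) = card T - real (rank_count \<sigma> T ({..<n} - I))" if "\<sigma> \<in> rankings n" for \<sigma>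
    using that by (metis add_diff_cancel_right' of_nat_add)
  have c: "real (card ({..<n} - I)) = n - real (card I)"
    using I card_mono[OF _ I] by (simp add: card_Diff_subset finite_subset of_nat_diff)
  have eq2: "card T * card ({..<n} - I) / n = card T - card T * card I / n"
    unfolding of_nat_mult c using n by (simp add: field_simps)
  have "{\<sigma> \<in> rankings n. real (rank_count \<sigma> T I) \<le> card T * card I / n - t} \<subseteq>
      {\<sigma> \<in> rankings n. real (rank_count \<sigma> T ({..<n} - I)) \<ge> card T * card ({..<n} - I) / n + t}"
  proof safe
    fix \<sigma> assume "\<sigma> \<in> rankings n" "real (rank_count \<sigma> T I) \<le> card T * card I / n - t"
    then show "real (rank_count \<sigma> T ({..<n} - I)) \<ge> card T * card ({..<n} - I) / n + t"
      using eq[of \<sigma>] eq2 by linarith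
  qed
  then have "card {\<sigma> \<in> rankings n. real (rank_count \<sigma> T I) \<le> card T * card I / n - t} \<le>
      card {\<sigma> \<in> rankings n. real (rank_count \<sigma> T ({..<n} - I)) \<ge> card T * card ({..<n} - I) / n + t}"
    by (intro card_mono) auto
  then show ?thesis using rank_count_upper_tail[OF T, of "{..<n} - I" t] t by force
qed

text \<open>The event says that all ranks of \<open>T\<close> avoid \<open>I\<close>, so
  \<open>card_rankings_in_le\<close> applies directly to the complement. Hoeffding's bound would be
  too weak for the windows below, where the mean is about k while |T| is k^7 or k^11.\<close>

lemma rank_count_zero_tail:
  assumes T: "T \<subseteq> {..<n}" and I: "I \<subseteq> {..<n}" and n: "n > 0"
  shows "real (card {\<sigma> \<in> rankings n. rank_count \<sigma> T I = 0}) \<le> fact n * exp (- (card T * card I / n))"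
proof -
  have fT: "finite T" using T(1) finite_subset by blast
  have "{\<sigma> \<in> rankings n. rank_count \<sigma> T I = 0} = rankings_in n T ({..<n} - I)"
    using fT T rankings_less_iff by (auto simp: rankings_in_def rank_count_def)
  then have "real (card {\<sigma> \<in> rankings n. rank_count \<sigma> T I = 0}) \<le> fact n * (card ({..<n} - I) / n) ^ card T"
    using card_rankings_in_le[OF T _ n, of "{..<n} - I"] by simp
  also have "real (card ({..<n} - I)) / n = 1 - card I / n"
    using I card_mono[OF _ I] n by (simp add: card_Diff_subset finite_subset of_nat_diff diff_divide_distrib)
  also have "fact n * (1 - card I / n) ^ card T \<le> fact n * exp (- (card I / n)) ^ card T"
  proof (intro mult_left_mono power_mono)
    show "1 - real (card I) / n \<le> exp (- (card I / n))"
      using exp_ge_add_one_self[of "- (card I / n)"] by simp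
    show "0 \<le> 1 - real (card I) / n" using I card_mono[OF _ I] n by simp
  qed auto
  also have "exp (- (card I / n)) ^ card T = exp (- (card T * card I / n))"
    by (simp flip: exp_of_nat_mult)
  finally show ?thesis .
qed

section \<open>Noise bits\<close>

definition noise :: "real \<Rightarrow> (nat \<Rightarrow> bool) measure" where
  "noise p = (\<Pi>\<^sub>M t\<in>UNIV. measure_pmf (bernoulli_pmf p))"

lemma run_space_eq: "run_space n p = uniform_count_measure (rankings n) \<Otimes>\<^sub>M noise p"
  by (simp add: run_space_def noise_def)

lemma space_noise [simp]: "space (noise p) = UNIV"
  by (simp add: noise_def space_PiM)

lemma space_run_space: "space (run_space n p) = rankings n \<times> UNIV"
  by (simp add: run_space_eq space_pair_measure space_uniform_count_measure)

lemma prob_space_noise: "prob_space (noise p)"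
  unfolding noise_def by (intro prob_space_PiM) (rule prob_space_measure_pmf)

lemma prob_space_rankings: "prob_space (uniform_count_measure (rankings n))"
  by (rule prob_space_uniform_count_measure) (auto simp: rankings_def finite_permutations intro: permutes_id)

lemma noise_component_measurable [measurable]: "(\<lambda>\<omega>. \<omega> t) \<in> measurable (noise p) (count_space UNIV)"
  unfolding noise_def
  using measurable_component_singleton[of t UNIV "\<lambda>_. measure_pmf (bernoulli_pmf p)"] by simp

text \<open>Such an event is a finite union of cylinders, one for each admissible pattern of the
  first \<open>T\<close> bits. Since an algorithm is an arbitrary function, this is the source of
  measurability for events of a run.\<close>

lemma sets_noise_finite_dep:
  assumes "\<And>\<omega> \<omega>'. (\<And>i. i < T \<Longrightarrow> \<omega> i = \<omega>' i) \<Longrightarrow> P \<omega> = P \<omega>'"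
  shows "{\<omega>. P \<omega>} \<in> sets (noise p)"
proof -
  have "{\<omega>. P \<omega>} = (\<Union>U\<in>{U\<in>Pow {..<T}. P (\<lambda>i. i \<in> U)}. {\<omega> \<in> space (noise p). \<forall>i\<in>{..<T}. \<omega> i = (i \<in> U)})"
  proof (intro equalityI subsetI)
    fix \<omega> assume "\<omega> \<in> {\<omega>. P \<omega>}"
    then have "P (\<lambda>i. i \<in> {i. i < T \<and> \<omega> i})" using assms[of \<omega> "\<lambda>i. i \<in> {i. i < T \<and> \<omega> i}"] by simp
    then show "\<omega> \<in> (\<Union>U\<in>{U\<in>Pow {..<T}. P (\<lambda>i. i \<in> U)}. {\<omega> \<in> space (noise p). \<forall>i\<in>{..<T}. \<omega> i = (i \<in> U)})"
      by (intro UN_I[of "{i. i < T \<and> \<omega> i}"]) auto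
  next
    fix \<omega> assume "\<omega> \<in> (\<Union>U\<in>{U\<in>Pow {..<T}. P (\<lambda>i. i \<in> U)}. {\<omega> \<in> space (noise p). \<forall>i\<in>{..<T}. \<omega> i = (i \<in> U)})"
    then obtain U where "P (\<lambda>i. i \<in> U)" "\<And>i. i < T \<Longrightarrow> \<omega> i = (i \<in> U)" by auto
    then show "\<omega> \<in> {\<omega>. P \<omega>}" using assms[of \<omega> "\<lambda>i. i \<in> U"] by simp
  qed
  also have "\<dots> \<in> sets (noise p)"
  proof (intro sets.finite_UN)
    fix U
    show "{\<omega> \<in> space (noise p). \<forall>i\<in>{..<T}. \<omega> i = (i \<in> U)} \<in> sets (noise p)" by measurable
  qed auto
  finally show ?thesis .
qed

lemma sets_run_space_finite_dep:
  assumes "\<And>\<sigma> \<omega> \<omega>'. \<sigma> \<in> rankings n \<Longrightarrow> (\<And>i. i < T \<Longrightarrow> \<omega> i = \<omega>' i) \<Longrightarrow> P \<sigma> \<omega> = P \<sigma> \<omega>'"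
  shows "{x \<in> rankings n \<times> UNIV. P (fst x) (snd x)} \<in> sets (run_space n p)"
proof -
  have "{x \<in> rankings n \<times> UNIV. P (fst x) (snd x)} = (\<Union>\<sigma>\<in>rankings n. {\<sigma>} \<times> {\<omega>. P \<sigma> \<omega>})" by auto
  also have "\<dots> \<in> sets (run_space n p)"
    unfolding run_space_eq
    by (intro sets.finite_UN finite_rankings pair_measureI sets_noise_finite_dep[of T])
       (auto simp: sets_uniform_count_measure dest: assms)
  finally show ?thesis .
qed

text \<open>Order and noise are independent, so the rectangle has product probability, and (1 - a)(1
  - b) \<ge> 1 - a - b. The price is a noise event \<open>N\<close> that serves all orders in
  \<open>G\<close> at once.\<close>

lemma prob_run_space_ge:
  assumes A: "A \<in> sets (run_space n p)" and G: "G \<subseteq> rankings n" and N: "N \<in> sets (noise p)"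
    and sub: "G \<times> N \<subseteq> A"
  shows "measure (run_space n p) A \<ge> 1 - card (rankings n - G) / fact n - measure (noise p) (UNIV - N)"
proof -
  interpret U: prob_space "uniform_count_measure (rankings n)" by (rule prob_space_rankings)
  interpret N: prob_space "noise p" by (rule prob_space_noise)
  interpret P: pair_prob_space "uniform_count_measure (rankings n)" "noise p" ..
  interpret R: prob_space "run_space n p" by (rule prob_space_run_space)
  have G': "G \<in> sets (uniform_count_measure (rankings n))" using G by (simp add: sets_uniform_count_measure)
  have "measure (run_space n p) (G \<times> N) = measure (uniform_count_measure (rankings n)) G * measure (noise p) N"
    unfolding run_space_eq measure_def
    by (subst N.emeasure_pair_measure_Times[OF G' N]) (simp add: enn2real_mult)
  moreover have "measure (uniform_count_measure (rankings n)) G = 1 - card (rankings n - G) / fact n"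
  proof -
    have "card (rankings n - G) = fact n - card G" "card G \<le> fact n"
      using G card_mono[OF finite_rankings G] by (auto simp: card_Diff_subset finite_subset card_rankings)
    then have "real (card (rankings n - G)) = fact n - real (card G)" by (simp add: of_nat_diff)
    then show ?thesis using G by (simp add: measure_uniform_count_measure card_rankings diff_divide_distrib)
  qed
  moreover have "measure (noise p) N = 1 - measure (noise p) (UNIV - N)"
    using N.prob_compl[OF N] by simp
  moreover have "(1 - a) * (1 - b) \<ge> 1 - a - b" if "a \<ge> 0" "b \<ge> 0" for a b :: real
    using mult_nonneg_nonneg[OF that] by (simp add: algebra_simps)
  moreover have "measure (run_space n p) (G \<times> N) \<le> measure (run_space n p) A"
    using sub A by (rule R.finite_measure_mono)
  ultimately show ?thesis by (smt (verit) divide_nonneg_nonneg fact_ge_zero measure_nonneg of_nat_0_le_iff)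
qed

text \<open>Independence means that the joint law is the product of the marginals, which is how
  \<open>noise\<close> is built. This feeds Hoeffding's inequality for majority votes.\<close>

lemma noise_indep_vars:
  "prob_space.indep_vars (noise p) (\<lambda>_. borel) (\<lambda>t \<omega>. of_bool (\<omega> t) :: real) J"
proof -
  interpret N: prob_space "noise p" by (rule prob_space_noise)
  have "N.indep_vars (\<lambda>_. count_space UNIV) (\<lambda>t \<omega>. \<omega> t) UNIV"
  proof (subst N.indep_vars_iff_distr_eq_PiM)
    have "distr (noise p) (\<Pi>\<^sub>M i\<in>UNIV. count_space UNIV) (\<lambda>x. \<lambda>i\<in>UNIV. x i) = distr (noise p) (noise p) (\<lambda>x. x)"
      by (rule distr_cong) (auto simp: noise_def intro!: sets_PiM_cong)
    also have "\<dots> = noise p" by (rule distr_id)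
    also have "\<dots> = (\<Pi>\<^sub>M i\<in>UNIV. distr (noise p) (count_space UNIV) (\<lambda>\<omega>. \<omega> i))"
      unfolding noise_def
    proof (intro PiM_cong refl)
      fix i :: nat
      have "distr (\<Pi>\<^sub>M t\<in>UNIV. measure_pmf (bernoulli_pmf p)) (measure_pmf (bernoulli_pmf p)) (\<lambda>\<omega>. \<omega> i) = measure_pmf (bernoulli_pmf p)"
        by (rule distr_PiM_component) (auto intro: prob_space_measure_pmf)
      then show "measure_pmf (bernoulli_pmf p) = distr (\<Pi>\<^sub>M t\<in>UNIV. measure_pmf (bernoulli_pmf p)) (count_space UNIV) (\<lambda>\<omega>. \<omega> i)"
        by (metis distr_cong sets_measure_pmf_count_space)
    qed
    finally show "distr (noise p) (\<Pi>\<^sub>M i\<in>UNIV. count_space UNIV) (\<lambda>x. \<lambda>i\<in>UNIV. x i) =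
      (\<Pi>\<^sub>M i\<in>UNIV. distr (noise p) (count_space UNIV) (\<lambda>\<omega>. \<omega> i))" .
  qed auto
  then have "N.indep_vars (\<lambda>_. borel) (\<lambda>t \<omega>. of_bool (\<omega> t) :: real) UNIV"
    by (rule N.indep_vars_compose2) auto
  then show ?thesis by (rule N.indep_vars_subset) auto
qed

lemma expectation_noise_component:
  assumes "0 \<le> p" "p \<le> 1"
  shows "integral\<^sup>L (noise p) (\<lambda>\<omega>. of_bool (\<omega> t) :: real) = p"
proof -
  have "integral\<^sup>L (measure_pmf (bernoulli_pmf p)) (of_bool :: bool \<Rightarrow> real) =
     integral\<^sup>L (distr (noise p) (measure_pmf (bernoulli_pmf p)) (\<lambda>\<omega>. \<omega> t)) of_bool"
    unfolding noise_def by (subst distr_PiM_component) (auto intro: prob_space_measure_pmf)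
  also have "\<dots> = integral\<^sup>L (noise p) (\<lambda>\<omega>. of_bool (\<omega> t))"
    by (subst integral_distr) (auto simp: measurable_cong_sets)
  finally show ?thesis using assms by simp
qed

lemma prob_noise_all_false:
  assumes "0 \<le> p" "p \<le> 1" "finite J"
  shows "measure (noise p) {\<omega>. \<forall>j\<in>J. \<not> \<omega> j} = (1 - p) ^ card J"
proof -
  interpret product_prob_space "\<lambda>_. measure_pmf (bernoulli_pmf p)" "UNIV :: nat set" ..
  have "{\<omega>. \<forall>j\<in>J. \<not> \<omega> j} = prod_emb UNIV (\<lambda>_. measure_pmf (bernoulli_pmf p)) J (\<Pi>\<^sub>E j\<in>J. {False})"
  proof -
    have "restrict \<omega> J = (\<lambda>x\<in>J. False) \<longleftrightarrow> (\<forall>j\<in>J. \<not> \<omega> j)" for \<omega>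
      by (auto simp: fun_eq_iff restrict_def)
    then show ?thesis by (intro set_eqI) (simp add: prod_emb_def space_PiM)
  qed
  then have "measure (noise p) {\<omega>. \<forall>j\<in>J. \<not> \<omega> j} = (\<Prod>j\<in>J. measure (measure_pmf (bernoulli_pmf p)) {False})"
    unfolding noise_def using assms by (simp only:) (subst measure_PiM_emb, auto)
  also have "\<dots> = (1 - p) ^ card J" using assms by (simp add: measure_pmf_single)
  finally show ?thesis .
qed

text \<open>Hoeffding's inequality for a deviation of \<open>card J * \<gamma> / 2\<close> below the
  mean \<open>card J * (1/2 + \<gamma>/2)\<close>: the exponent is 2 (|J| \<gamma> / 2)^2 / |J|. A
  tie counts as failure.\<close>

lemma prob_noise_majority_false:
  fixes \<gamma> :: real
  assumes \<gamma>: "0 < \<gamma>" "\<gamma> \<le> 1" and J: "finite J" "J \<noteq> {}"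
  shows "measure (noise (1/2 + \<gamma>/2)) {\<omega>. 2 * card {j\<in>J. \<omega> j} \<le> card J} \<le> exp (- (card J * \<gamma>\<^sup>2 / 2))"
proof -
  let ?N = "noise (1/2 + \<gamma>/2)"
  interpret N: prob_space ?N by (rule prob_space_noise)
  interpret H: Hoeffding_ineq ?N J "\<lambda>j \<omega>. of_bool (\<omega> j)" "\<lambda>_. 0" "\<lambda>_. 1" "card J * (1/2 + \<gamma>/2)"
    by unfold_locales
       (use J \<gamma> in \<open>auto simp: noise_indep_vars expectation_noise_component\<close>)
  have c: "card J > 0" using J by (simp add: card_gt_0_iff)
  have "{\<omega>. 2 * card {j\<in>J. \<omega> j} \<le> card J} =
    {\<omega> \<in> space ?N. (\<Sum>j\<in>J. of_bool (\<omega> j)) \<le> card J * (1/2 + \<gamma>/2) - card J * \<gamma> / 2}"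
  proof -
    have "(2 * card {j\<in>J. \<omega> j} \<le> card J) \<longleftrightarrow> (\<Sum>j\<in>J. of_bool (\<omega> j)) \<le> card J * (1/2 + \<gamma>/2) - card J * \<gamma> / 2" for \<omega>
    proof -
      have "(\<Sum>j\<in>J. of_bool (\<omega> j)) = real (card {j\<in>J. \<omega> j})"
        using J by (simp add: of_bool_def sum.If_cases Int_def)
      moreover have "(2 * card {j\<in>J. \<omega> j} \<le> card J) \<longleftrightarrow> 2 * real (card {j\<in>J. \<omega> j}) \<le> real (card J)" by linarith
      ultimately show ?thesis by (simp add: field_simps)
    qed
    then show ?thesis by simp
  qed
  moreover have "N.prob {\<omega> \<in> space ?N. (\<Sum>j\<in>J. of_bool (\<omega> j)) \<le> card J * (1/2 + \<gamma>/2) - card J * \<gamma> / 2}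
     \<le> exp (- 2 * (card J * \<gamma> / 2)\<^sup>2 / (\<Sum>j\<in>J. (1 - 0)\<^sup>2))"
    using c \<gamma> by (intro H.Hoeffding_ineq_le) auto
  ultimately show ?thesis using c by (simp add: power2_eq_square mult_ac)
qed

text \<open>A coin sequence is a fresh flip followed by an independent copy of the sequence. This
  permits first-step analysis of waiting times.\<close>

lemma nn_integral_noise_shift:
  assumes p: "0 \<le> p" "p \<le> 1" and f: "f \<in> borel_measurable (noise p)"
  shows "(\<integral>\<^sup>+\<omega>. f \<omega> \<partial>noise p) =
    ennreal p * (\<integral>\<^sup>+\<omega>. f (case_nat True \<omega>) \<partial>noise p) + ennreal (1 - p) * (\<integral>\<^sup>+\<omega>. f (case_nat False \<omega>) \<partial>noise p)"
proof -
  interpret sequence_space "measure_pmf (bernoulli_pmf p)" ..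
  have S: "S = noise p" by (simp add: noise_def)
  interpret N: prob_space "noise p" by (rule prob_space_noise)
  have m: "(\<lambda>(s, \<omega>). case_nat s \<omega>) \<in> measurable (measure_pmf (bernoulli_pmf p) \<Otimes>\<^sub>M S) S" by measurable
  have "(\<integral>\<^sup>+\<omega>. f \<omega> \<partial>noise p) = (\<integral>\<^sup>+\<omega>. f \<omega> \<partial>distr (measure_pmf (bernoulli_pmf p) \<Otimes>\<^sub>M S) S (\<lambda>(s, \<omega>). case_nat s \<omega>))"
    using PiM_iter by (simp add: S)
  also have "\<dots> = (\<integral>\<^sup>+x. f (case_nat (fst x) (snd x)) \<partial>(measure_pmf (bernoulli_pmf p) \<Otimes>\<^sub>M S))"
    using f by (subst nn_integral_distr[OF m]) (auto simp: S split_beta')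
  also have "\<dots> = (\<integral>\<^sup>+s. \<integral>\<^sup>+\<omega>. f (case_nat s \<omega>) \<partial>S \<partial>measure_pmf (bernoulli_pmf p))"
    unfolding S
    by (subst N.nn_integral_fst[symmetric])
       (use f m in \<open>auto simp: S split_beta' intro: measurable_compose\<close>)
  also have "\<dots> = ennreal p * (\<integral>\<^sup>+\<omega>. f (case_nat True \<omega>) \<partial>noise p) + ennreal (1 - p) * (\<integral>\<^sup>+\<omega>. f (case_nat False \<omega>) \<partial>noise p)"
    using p by (simp add: S mult.commute)
  finally show ?thesis .
qed

section \<open>Waiting times for heads\<close>

definition heads :: "(nat \<Rightarrow> bool) \<Rightarrow> nat \<Rightarrow> nat" where
  "heads \<omega> t = card {i. i < t \<and> \<omega> i}"

lemma heads_0 [simp]: "heads \<omega> 0 = 0"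
  by (simp add: heads_def)

lemma heads_Suc: "heads \<omega> (Suc t) = heads \<omega> t + of_bool (\<omega> t)"
proof -
  have "{i. i < Suc t \<and> \<omega> i} = {i. i < t \<and> \<omega> i} \<union> (if \<omega> t then {t} else {})" by (auto simp: less_Suc_eq)
  then show ?thesis by (simp add: heads_def)
qed

lemma heads_cong: "(\<And>i. i < t \<Longrightarrow> \<omega> i = \<omega>' i) \<Longrightarrow> heads \<omega> t = heads \<omega>' t"
  unfolding heads_def by (intro arg_cong[where f = card]) auto

lemma heads_case_nat: "heads (case_nat b \<omega>) (Suc t) = of_bool b + heads \<omega> t"
  by (induction t) (auto simp: heads_Suc)

text \<open>The number of flips made until the \<open>K\<close>-th head, cut off at
  \<open>T\<close>: flip \<open>t\<close> is made iff fewer than \<open>K\<close> heads precede it.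
  The cut leaves a function of finitely many bits and allows induction on \<open>T\<close>; the true
  waiting time is the supremum over \<open>T\<close>.\<close>

definition waiting :: "nat \<Rightarrow> nat \<Rightarrow> (nat \<Rightarrow> bool) \<Rightarrow> nat" where
  "waiting K T \<omega> = card {t. t < T \<and> heads \<omega> t < K}"

lemma waiting_Suc: "waiting K (Suc T) \<omega> = waiting K T \<omega> + of_bool (heads \<omega> T < K)"
proof -
  have "{t. t < Suc T \<and> heads \<omega> t < K} = {t. t < T \<and> heads \<omega> t < K} \<union> (if heads \<omega> T < K then {T} else {})"
    by (auto simp: less_Suc_eq)
  then show ?thesis by (simp add: waiting_def)
qed

lemma waiting_0 [simp]: "waiting K 0 \<omega> = 0"
  by (simp add: waiting_def)

lemma waiting_zero [simp]: "waiting 0 T \<omega> = 0"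
  by (simp add: waiting_def)

text \<open>The first flip is always paid for, and a head lowers the goal by one.\<close>

lemma waiting_case_nat: "waiting (Suc K) (Suc T) (case_nat b \<omega>) = Suc (waiting (if b then K else Suc K) T \<omega>)"
proof (induction T)
  case 0
  then show ?case by (simp add: waiting_Suc)
next
  case (Suc T)
  have "waiting (Suc K) (Suc (Suc T)) (case_nat b \<omega>) =
     waiting (Suc K) (Suc T) (case_nat b \<omega>) + of_bool (heads (case_nat b \<omega>) (Suc T) < Suc K)"
    by (rule waiting_Suc)
  then show ?case unfolding Suc by (simp add: waiting_Suc heads_case_nat)
qed

lemma waiting_cong: "(\<And>i. i < T \<Longrightarrow> \<omega> i = \<omega>' i) \<Longrightarrow> waiting K T \<omega> = waiting K T \<omega>'"
proof -
  assume "\<And>i. i < T \<Longrightarrow> \<omega> i = \<omega>' i"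
  then have "heads \<omega> t = heads \<omega>' t" if "t < T" for t using that by (intro heads_cong) auto
  then show ?thesis unfolding waiting_def by (intro arg_cong[where f = card]) auto
qed

lemma waiting_measurable [measurable]: "waiting K T \<in> measurable (noise p) (count_space UNIV)"
proof (rule measurableI)
  fix A
  have "{\<omega>. waiting K T \<omega> \<in> A} \<in> sets (noise p)"
    by (rule sets_noise_finite_dep[of T]) (use waiting_cong in metis)
  then show "waiting K T -` A \<inter> space (noise p) \<in> sets (noise p)" by (simp add: vimage_def)
qed auto

text \<open>First-step analysis by induction on the cut-off. The bound, the mean of a negative
  binomial waiting time, is free of \<open>T\<close> and so survives the passage to the
  supremum.\<close>

lemma expectation_waiting_le:
  assumes p: "0 < p" "p \<le> 1"
  shows "(\<integral>\<^sup>+\<omega>. of_nat (waiting K T \<omega>) \<partial>noise p) \<le> ennreal (K / p)"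
proof (induction T arbitrary: K)
  case 0
  then show ?case by simp
next
  case (Suc T)
  interpret N: prob_space "noise p" by (rule prob_space_noise)
  show ?case
  proof (cases K)
    case 0
    then show ?thesis by simp
  next
    case (Suc K')
    have m: "(\<lambda>\<omega>. of_nat (waiting K T \<omega>) :: ennreal) \<in> borel_measurable (noise p)" for K T by measurable
    have "(\<integral>\<^sup>+\<omega>. of_nat (waiting (Suc K') (Suc T) \<omega>) \<partial>noise p) =
      ennreal p * (\<integral>\<^sup>+\<omega>. 1 + of_nat (waiting K' T \<omega>) \<partial>noise p) +
      ennreal (1 - p) * (\<integral>\<^sup>+\<omega>. 1 + of_nat (waiting (Suc K') T \<omega>) \<partial>noise p)"
      using p by (subst nn_integral_noise_shift) (auto simp: waiting_case_nat)
    also have "\<dots> = ennreal p * (1 + (\<integral>\<^sup>+\<omega>. of_nat (waiting K' T \<omega>) \<partial>noise p)) +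
      ennreal (1 - p) * (1 + (\<integral>\<^sup>+\<omega>. of_nat (waiting (Suc K') T \<omega>) \<partial>noise p))"
      by (subst (1 2) nn_integral_add) (auto simp: N.emeasure_space_1[simplified])
    also have "\<dots> \<le> ennreal p * (1 + ennreal (K' / p)) + ennreal (1 - p) * (1 + ennreal (Suc K' / p))"
      by (intro add_mono mult_left_mono Suc.IH) auto
    also have "\<dots> = ennreal (p * (1 + K' / p) + (1 - p) * (1 + Suc K' / p))"
      using p by (simp flip: ennreal_plus ennreal_mult ennreal_1)
    \<comment> \<open>The value \<open>K / p\<close> is a fixed point of the first-step
      recursion.\<close>
    also have "p * (1 + K' / p) + (1 - p) * (1 + Suc K' / p) = Suc K' / p"
      using p by (simp add: field_simps)
    finally show ?thesis using Suc by simp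
  qed
qed

section \<open>Simulating noiseless algorithms under noise\<close>

text \<open>The queries of each round, given the pairs \<open>(x, y)\<close> for which \<open>x\<close> is known to lie below \<open>y\<close>.\<close>

type_synonym scheme = "nat \<Rightarrow> nat rel \<Rightarrow> (nat \<times> nat) list"

definition truth :: "(nat \<Rightarrow> nat) \<Rightarrow> nat \<times> nat \<Rightarrow> bool" where
  "truth \<sigma> q \<longleftrightarrow> \<sigma> (fst q) < \<sigma> (snd q)"

definition learned :: "(nat \<times> nat) list \<Rightarrow> bool list \<Rightarrow> nat rel" where
  "learned qs bs = (\<lambda>(q, b). if b then q else prod.swap q) ` set (zip qs bs)"

primrec noiseless :: "scheme \<Rightarrow> (nat \<Rightarrow> nat) \<Rightarrow> nat \<Rightarrow> nat rel" where
  "noiseless Q \<sigma> 0 = {}"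
| "noiseless Q \<sigma> (Suc j) =
     noiseless Q \<sigma> j \<union> learned (Q j (noiseless Q \<sigma> j)) (map (truth \<sigma>) (Q j (noiseless Q \<sigma> j)))"

text \<open>The queries of \<open>r\<close> rounds from round \<open>j\<close> on, as a function of
  the order alone. The start \<open>j\<close> is a parameter because the serial simulation peels
  rounds off the front, while the parallel one appends them at the end.\<close>

definition transcript :: "scheme \<Rightarrow> (nat \<Rightarrow> nat) \<Rightarrow> nat \<Rightarrow> nat \<Rightarrow> (nat \<times> nat) list" where
  "transcript Q \<sigma> j r = concat (map (\<lambda>i. Q i (noiseless Q \<sigma> i)) [j..<j + r])"

definition valid_scheme :: "nat \<Rightarrow> scheme \<Rightarrow> bool" where
  "valid_scheme n Q \<longleftrightarrow> (\<forall>j E. \<forall>q \<in> set (Q j E). fst q < n \<and> snd q < n \<and> fst q \<noteq> snd q)"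

lemma history_Suc_Output: "A (history ans A \<sigma> \<omega> k) = Output y \<Longrightarrow> history ans A \<sigma> \<omega> (Suc k) = history ans A \<sigma> \<omega> k"
  by (simp add: Let_def)

lemma history_Suc_Ask:
  "A (history ans A \<sigma> \<omega> k) = Ask qs \<Longrightarrow> history ans A \<sigma> \<omega> (Suc k) = history ans A \<sigma> \<omega> k @
     [map (\<lambda>i. ans (\<omega> (length (concat (history ans A \<sigma> \<omega> k)) + i)) (truth \<sigma> (qs ! i))) [0..<length qs]]"
  by (simp add: Let_def truth_def)

text \<open>A run reads one bit per query and nothing else. Together with a bound on the number of
  queries this makes its events finitely determined, hence measurable.\<close>

lemma history_finite_dep:
  assumes "length (concat (history ans A \<sigma> \<omega> k)) \<le> T" "\<And>i. i < T \<Longrightarrow> \<omega> i = \<omega>' i"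
  shows "history ans A \<sigma> \<omega>' k = history ans A \<sigma> \<omega> k"
  using assms(1)
proof (induction k)
  case 0
  then show ?case by simp
next
  case (Suc k)
  show ?case
  proof (cases "A (history ans A \<sigma> \<omega> k)")
    case (Ask qs)
    note S = history_Suc_Ask[of A ans \<sigma>, OF Ask]
    have len: "length (concat (history ans A \<sigma> \<omega> k)) + length qs \<le> T"
      using Suc.prems unfolding S by simp
    then have IH: "history ans A \<sigma> \<omega>' k = history ans A \<sigma> \<omega> k" by (intro Suc.IH) simp
    then have "A (history ans A \<sigma> \<omega>' k) = Ask qs" using Ask by simp
    note S' = history_Suc_Ask[of A ans \<sigma>, OF this]
    have "history ans A \<sigma> \<omega>' (Suc k) = history ans A \<sigma> \<omega> (Suc k)"
      unfolding S S' IH using len assms(2) by simp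
    then show ?thesis .
  next
    case (Output y)
    then show ?thesis using Suc by (simp add: history_Suc_Output[of A ans \<sigma>] del: history.simps)
  qed
qed

section \<open>Repeating each query within its round\<close>

primrec replay :: "scheme \<Rightarrow> ('r list \<Rightarrow> bool) \<Rightarrow> nat \<Rightarrow> 'r list list \<Rightarrow> nat \<Rightarrow> nat rel" where
  "replay Q dec m h 0 = {}"
| "replay Q dec m h (Suc j) = replay Q dec m h j \<union>
     learned (Q j (replay Q dec m h j))
       (map (\<lambda>i. dec (map (\<lambda>l. h ! j ! (i * m + l)) [0..<m])) [0..<length (Q j (replay Q dec m h j))])"

lemma replay_append: "j \<le> length h \<Longrightarrow> replay Q dec m (h @ h') j = replay Q dec m h j"
  by (induction j) (auto simp: nth_append)

text \<open>Position \<open>i\<close> of a round repeats query \<open>i div m\<close>, so the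
  answers to one query are \<open>m\<close> consecutive ones, the block that \<open>replay\<close>
  decodes. The known relation is recomputed in every round, since the answers are all that an
  algorithm receives.\<close>

definition rounds_alg :: "scheme \<Rightarrow> ('r list \<Rightarrow> bool) \<Rightarrow> nat \<Rightarrow> nat \<Rightarrow> (nat rel \<Rightarrow> 'o) \<Rightarrow> ('r, 'o) algorithm" where
  "rounds_alg Q dec m R out h =
     (if length h < R
      then Ask (let qs = Q (length h) (replay Q dec m h (length h)) in map (\<lambda>i. qs ! (i div m)) [0..<length qs * m])
      else Output (out (replay Q dec m h R)))"

lemma valid_rounds_alg:
  assumes "valid_scheme n Q"
  shows "valid_algorithm n (rounds_alg Q dec m R out)"
proof -
  have "\<forall>(x, y) \<in> set qs'. x < n \<and> y < n \<and> x \<noteq> y"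
    if "rounds_alg Q dec m R out h = Ask qs'" for h qs'
  proof -
    define qs where "qs = Q (length h) (replay Q dec m h (length h))"
    have "qs' = map (\<lambda>i. qs ! (i div m)) [0..<length qs * m]"
      using that by (auto simp: rounds_alg_def qs_def Let_def split: if_splits)
    then have "set qs' \<subseteq> set qs" by (auto simp: less_mult_imp_div_less)
    then show ?thesis using assms unfolding valid_scheme_def qs_def by fastforce
  qed
  then show ?thesis unfolding valid_algorithm_def by blast
qed

text \<open>This holds for every noise sequence, even after wrong decoding, because \<open>K\<close>
  bounds the scheme on arbitrary relations.\<close>

lemma rounds_alg_history_bounds:
  fixes Q :: scheme and dec :: "'r list \<Rightarrow> bool" and m R :: nat and out :: "nat rel \<Rightarrow> 'o"
  assumes K: "\<And>j E. length (Q j E) \<le> K"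
  defines "A \<equiv> rounds_alg Q dec m R out"
  shows "length (history ans A \<sigma> \<omega> k) \<le> R" (is ?r)
    and "length (concat (history ans A \<sigma> \<omega> k)) \<le> R * (K * m)" (is ?q)
proof -
  have "length (history ans A \<sigma> \<omega> k) \<le> R \<and>
    length (concat (history ans A \<sigma> \<omega> k)) \<le> length (history ans A \<sigma> \<omega> k) * (K * m)" for k
  proof (induction k)
    case 0
    then show ?case by simp
  next
    case (Suc k)
    let ?h = "history ans A \<sigma> \<omega> k"
    show ?case
    proof (cases "length ?h < R")
      case True
      define qs where "qs = Q (length ?h) (replay Q dec m ?h (length ?h))"
      have *: "A ?h = Ask (map (\<lambda>i. qs ! (i div m)) [0..<length qs * m])"
        using True by (simp add: A_def rounds_alg_def qs_def Let_def)
      have "length qs * m \<le> K * m" unfolding qs_def by (intro mult_right_mono K) simp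
      moreover have "length (concat (history ans A \<sigma> \<omega> (Suc k))) = length (concat ?h) + length qs * m"
        "length (history ans A \<sigma> \<omega> (Suc k)) = Suc (length ?h)"
        unfolding history_Suc_Ask[of A ans \<sigma>, OF *] by simp_all
      ultimately show ?thesis using Suc True by (simp only: mult_Suc) linarith
    next
      case False
      then have "A ?h = Output (out (replay Q dec m ?h R))" by (simp add: A_def rounds_alg_def)
      then show ?thesis using Suc by (simp add: history_Suc_Output[of A ans \<sigma>] del: history.simps)
    qed
  qed
  from this[of k] show ?r ?q
    by (auto intro: order.trans[OF _ mult_right_mono])
qed

lemma rounds_alg_bounded:
  assumes K: "\<And>j E. length (Q j E) \<le> K"
  shows "queries_bounded n ans (rounds_alg Q dec m R out) (R * (K * m))"
    and "rounds_bounded n ans (rounds_alg Q dec m R out) R"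
proof -
  have "ennreal (real (R * (K * m))) = of_nat (R * (K * m))" by (rule ennreal_of_nat_eq_real_of_nat[symmetric])
  then show "queries_bounded n ans (rounds_alg Q dec m R out) (R * (K * m))"
    unfolding queries_bounded_def num_queries_def
    by (auto intro!: SUP_least simp del: of_nat_mult)
       (metis (no_types) K of_nat_le_iff rounds_alg_history_bounds(2))
  show "rounds_bounded n ans (rounds_alg Q dec m R out) R"
    unfolding rounds_bounded_def num_rounds_def
    by (auto intro!: SUP_least rounds_alg_history_bounds[OF K])
qed

text \<open>Both correct answers \<open>b\<close> are covered, so the event concerns the noise only
  and not the query that falls to block \<open>i\<close>. Hence a union bound over block numbers
  works although queries are adaptive.\<close>

definition good_block :: "(bool \<Rightarrow> bool \<Rightarrow> 'r) \<Rightarrow> ('r list \<Rightarrow> bool) \<Rightarrow> nat \<Rightarrow> (nat \<Rightarrow> bool) \<Rightarrow> nat \<Rightarrow> bool" where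
  "good_block ans dec m \<omega> i \<longleftrightarrow> (\<forall>b. dec (map (\<lambda>l. ans (\<omega> (i * m + l)) b) [0..<m]) = b)"

lemma transcript_0_Suc: "transcript Q \<sigma> 0 (Suc k) = transcript Q \<sigma> 0 k @ Q k (noiseless Q \<sigma> k)"
  by (simp add: transcript_def)

lemma length_transcript_mono: "k \<le> R \<Longrightarrow> length (transcript Q \<sigma> 0 k) \<le> length (transcript Q \<sigma> 0 R)"
  by (induction R rule: dec_induct) (auto simp: transcript_0_Suc)

text \<open>While decoding is correct, the queries asked are those of the noiseless run and each
  round consumes a multiple of \<open>m\<close> bits. So query \<open>i\<close> of the current round
  uses noise block \<open>t + i\<close>, where \<open>t\<close> counts the earlier queries of the
  transcript. The three claims need each other in the induction.\<close>

lemma rounds_alg_correct_decoding: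
  fixes Q :: scheme and dec :: "'r list \<Rightarrow> bool" and m R :: nat and out :: "nat rel \<Rightarrow> 'o"
  assumes good: "\<And>i. i < length (transcript Q \<sigma> 0 R) \<Longrightarrow> good_block ans dec m \<omega> i"
    and "k \<le> R"
  defines "A \<equiv> rounds_alg Q dec m R out"
  shows "length (history ans A \<sigma> \<omega> k) = k
    \<and> length (concat (history ans A \<sigma> \<omega> k)) = length (transcript Q \<sigma> 0 k) * m
    \<and> replay Q dec m (history ans A \<sigma> \<omega> k) k = noiseless Q \<sigma> k"
  using assms(2)
proof (induction k)
  case 0
  then show ?case by (simp add: transcript_def)
next
  case (Suc k)
  let ?h = "history ans A \<sigma> \<omega> k"
  define qs where "qs = Q k (noiseless Q \<sigma> k)"
  define t where "t = length (transcript Q \<sigma> 0 k)"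
  have IH: "length ?h = k" "length (concat ?h) = t * m" "replay Q dec m ?h k = noiseless Q \<sigma> k"
    using Suc by (auto simp: t_def)
  have *: "A ?h = Ask (map (\<lambda>i. qs ! (i div m)) [0..<length qs * m])"
    using IH Suc.prems by (simp add: A_def rounds_alg_def qs_def Let_def)
  define new where "new = map (\<lambda>i. ans (\<omega> (t * m + i)) (truth \<sigma> (qs ! (i div m)))) [0..<length qs * m]"
  have H: "history ans A \<sigma> \<omega> (Suc k) = ?h @ [new]"
    unfolding history_Suc_Ask[of A ans \<sigma>, OF *] IH new_def by simp
  have dec: "dec (map (\<lambda>l. new ! (i * m + l)) [0..<m]) = truth \<sigma> (qs ! i)" if i: "i < length qs" for i
  proof -
    have "t + i < length (transcript Q \<sigma> 0 (Suc k))" using i by (simp add: transcript_0_Suc t_def qs_def)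
    also have "\<dots> \<le> length (transcript Q \<sigma> 0 R)" by (rule length_transcript_mono[OF Suc.prems])
    finally have g: "good_block ans dec m \<omega> (t + i)" by (rule good)
    have "new ! (i * m + l) = ans (\<omega> ((t + i) * m + l)) (truth \<sigma> (qs ! i))" if "l < m" for l
    proof -
      have "i * m + l < length qs * m"
      proof -
        have "i * m + l < Suc i * m" using that by simp
        also have "\<dots> \<le> length qs * m" using i by (intro mult_right_mono) auto
        finally show ?thesis .
      qed
      moreover have "(i * m + l) div m = i" using that by simp
      ultimately show ?thesis by (simp add: new_def algebra_simps)
    qed
    then have "map (\<lambda>l. new ! (i * m + l)) [0..<m] = map (\<lambda>l. ans (\<omega> ((t + i) * m + l)) (truth \<sigma> (qs ! i))) [0..<m]"
      by simp
    then show ?thesis using g unfolding good_block_def by metis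
  qed
  have "replay Q dec m (?h @ [new]) (Suc k) = noiseless Q \<sigma> (Suc k)"
  proof -
    have r: "replay Q dec m (?h @ [new]) k = noiseless Q \<sigma> k" using IH by (simp add: replay_append)
    have "map (\<lambda>i. dec (map (\<lambda>l. new ! (i * m + l)) [0..<m])) [0..<length qs] = map (truth \<sigma>) qs"
      using dec by (intro nth_equalityI) auto
    then show ?thesis using IH(1) by (simp add: r nth_append flip: qs_def)
  qed
  then show ?case unfolding H using IH
    by (simp add: new_def transcript_0_Suc t_def qs_def algebra_simps)
qed

lemma rounds_alg_outputs:
  assumes "\<And>i. i < length (transcript Q \<sigma> 0 R) \<Longrightarrow> good_block ans dec m \<omega> i"
  shows "outputs ans (rounds_alg Q dec m R out) \<sigma> \<omega> (out (noiseless Q \<sigma> R))"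
  using rounds_alg_correct_decoding[of Q \<sigma> R ans dec m \<omega> R out] assms
  unfolding outputs_def by (intro exI[of _ R]) (simp add: rounds_alg_def)

text \<open>The first \<open>R * K\<close> blocks cover the transcript of every order, so the event
  that all of them are good does not depend on the order and \<open>prob_run_space_ge\<close>
  applies.\<close>

lemma success_prob_rounds_alg:
  assumes K: "\<And>j E. length (Q j E) \<le> K" and G: "G \<subseteq> rankings n"
    and corr: "\<And>\<sigma>. \<sigma> \<in> G \<Longrightarrow> correct n \<sigma> (out (noiseless Q \<sigma> R))"
    and \<delta>: "\<And>i. measure (noise p) {\<omega>. \<not> good_block ans dec m \<omega> i} \<le> \<delta>"
  shows "success_prob n p ans correct (rounds_alg Q dec m R out) \<ge>
    1 - card (rankings n - G) / fact n - R * K * \<delta>"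
proof -
  interpret N: prob_space "noise p" by (rule prob_space_noise)
  define A where "A = rounds_alg Q dec m R out"
  define B where "B = {x \<in> rankings n \<times> UNIV. \<exists>y. outputs ans A (fst x) (snd x) y \<and> correct n (fst x) y}"
  define N where "N = {\<omega>. \<forall>i\<in>{..<R * K}. good_block ans dec m \<omega> i}"
  have bad: "{\<omega>. \<not> good_block ans dec m \<omega> i} \<in> sets (noise p)" for i
  proof (rule sets_noise_finite_dep[of "Suc i * m"])
    fix \<omega> \<omega>' :: "nat \<Rightarrow> bool" assume "\<And>j. j < Suc i * m \<Longrightarrow> \<omega> j = \<omega>' j"
    then have "map (\<lambda>l. ans (\<omega> (i * m + l)) b) [0..<m] = map (\<lambda>l. ans (\<omega>' (i * m + l)) b) [0..<m]" for b by simp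
    then show "(\<not> good_block ans dec m \<omega> i) = (\<not> good_block ans dec m \<omega>' i)" unfolding good_block_def by (simp only:)
  qed
  have N_compl: "UNIV - N = (\<Union>i\<in>{..<R * K}. {\<omega>. \<not> good_block ans dec m \<omega> i})" by (auto simp: N_def)
  then have "UNIV - N \<in> sets (noise p)" using bad by (simp only:) (intro sets.finite_UN, auto)
  then have N: "N \<in> sets (noise p)"
    using sets.compl_sets[of "UNIV - N" "noise p"] by (simp add: Diff_Diff_Int)
  have "measure (noise p) (UNIV - N) \<le> (\<Sum>i\<in>{..<R * K}. measure (noise p) {\<omega>. \<not> good_block ans dec m \<omega> i})"
    unfolding N_compl using bad by (intro N.finite_measure_subadditive_finite) auto
  also have "\<dots> \<le> (\<Sum>i\<in>{..<R * K}. \<delta>)" by (intro sum_mono \<delta>)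
  finally have Nd: "measure (noise p) (UNIV - N) \<le> R * K * \<delta>" by simp
  have B: "B \<in> sets (run_space n p)"
    unfolding B_def
  proof (rule sets_run_space_finite_dep[of n "R * (K * m)"])
    fix \<sigma> and \<omega> \<omega>' :: "nat \<Rightarrow> bool" assume *: "\<And>i. i < R * (K * m) \<Longrightarrow> \<omega> i = \<omega>' i"
    have "history ans A \<sigma> \<omega>' k = history ans A \<sigma> \<omega> k" for k
      using rounds_alg_history_bounds(2)[of Q K, OF K] * unfolding A_def by (rule history_finite_dep)
    then show "(\<exists>y. outputs ans A \<sigma> \<omega> y \<and> correct n \<sigma> y) = (\<exists>y. outputs ans A \<sigma> \<omega>' y \<and> correct n \<sigma> y)"
      by (simp add: outputs_def)
  qed
  have "G \<times> N \<subseteq> B"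
  proof safe
    fix \<sigma> \<omega> assume \<sigma>: "\<sigma> \<in> G" and \<omega>: "\<omega> \<in> N"
    have "length (transcript Q \<sigma> 0 k) \<le> k * K" for k
    proof (induction k)
      case (Suc k)
      then show ?case using K[of k "noiseless Q \<sigma> k"] by (simp add: transcript_0_Suc)
    qed (simp add: transcript_def)
    then have "i < length (transcript Q \<sigma> 0 R) \<Longrightarrow> good_block ans dec m \<omega> i" for i
      using \<omega> by (auto simp: N_def dest: less_le_trans)
    then have "outputs ans A \<sigma> \<omega> (out (noiseless Q \<sigma> R))"
      unfolding A_def by (rule rounds_alg_outputs)
    then show "(\<sigma>, \<omega>) \<in> B" using \<sigma> G corr by (auto simp: B_def)
  qed
  then have "measure (run_space n p) B \<ge> 1 - card (rankings n - G) / fact n - measure (noise p) (UNIV - N)"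
    by (intro prob_run_space_ge B G N)
  also have "measure (run_space n p) B = success_prob n p ans correct A"
    unfolding success_prob_def B_def by (intro arg_cong[where f = "measure _"]) (auto simp: space_run_space)
  finally show ?thesis using Nd by (simp add: A_def)
qed

section \<open>Asking the queries one by one under erasures\<close>

primrec serial :: "scheme \<Rightarrow> (nat rel \<Rightarrow> 'o) \<Rightarrow> nat \<Rightarrow> nat \<Rightarrow> nat rel \<Rightarrow> bool list \<Rightarrow> 'o action" where
  "serial Q out 0 j E bs = Output (out E)"
| "serial Q out (Suc r) j E bs =
     (if length bs < length (Q j E) then Ask [Q j E ! length bs]
      else serial Q out r (Suc j) (E \<union> learned (Q j E) bs) (drop (length (Q j E)) bs))"

lemma transcript_Suc: "transcript Q \<sigma> j (Suc r) = Q j (noiseless Q \<sigma> j) @ transcript Q \<sigma> (Suc j) r"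
  unfolding transcript_def by (subst upt_conv_Cons) auto

text \<open>\<open>serial\<close> hands all remaining answers to \<open>learned\<close>, including
  those of later rounds; \<open>zip\<close> drops the surplus.\<close>

lemma learned_append: "length bs = length qs \<Longrightarrow> learned qs (bs @ cs) = learned qs bs"
  by (simp add: learned_def zip_append2)

text \<open>The number of true answers alone fixes the position in the transcript, across the
  boundaries of rounds. Later \<open>N\<close> is the number of heads so far.\<close>

lemma serial_transcript:
  "serial Q out r j (noiseless Q \<sigma> j) (map (truth \<sigma>) (take N (transcript Q \<sigma> j r))) =
    (if N < length (transcript Q \<sigma> j r) then Ask [transcript Q \<sigma> j r ! N] else Output (out (noiseless Q \<sigma> (j + r))))"
proof (induction r arbitrary: j N)
  case 0
  then show ?case by (simp add: transcript_def)
next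
  case (Suc r)
  let ?qs = "Q j (noiseless Q \<sigma> j)"
  show ?case
  proof (cases "N < length ?qs")
    case True
    then show ?thesis by (simp add: transcript_Suc nth_append)
  next
    case False
    then show ?thesis using Suc[of "Suc j" "N - length ?qs"]
      by (auto simp: transcript_Suc nth_append learned_append)
  qed
qed

text \<open>Each round of the model asks a single query. An erased answer is filtered out, so the
  state is unchanged and the same query is asked again.\<close>

definition serial_alg :: "scheme \<Rightarrow> nat \<Rightarrow> (nat rel \<Rightarrow> 'o) \<Rightarrow> (bool option, 'o) algorithm" where
  "serial_alg Q R out h = serial Q out R 0 {} (map the (filter (\<lambda>a. a \<noteq> None) (concat h)))"

lemma valid_serial_alg:
  assumes "valid_scheme n Q"
  shows "valid_algorithm n (serial_alg Q R out)"
proof -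
  have "\<forall>(x, y) \<in> set qs. x < n \<and> y < n \<and> x \<noteq> y" if "serial Q out r j E bs = Ask qs" for r j E bs qs
    using that
  proof (induction r arbitrary: j E bs)
    case (Suc r)
    then show ?case
    proof (cases "length bs < length (Q j E)")
      case True
      then have "qs = [Q j E ! length bs]" "Q j E ! length bs \<in> set (Q j E)" using Suc.prems by auto
      moreover obtain a b where "Q j E ! length bs = (a, b)" by fastforce
      ultimately show ?thesis using assms by (fastforce simp: valid_scheme_def)
    next
      case False
      then have "serial Q out r (Suc j) (E \<union> learned (Q j E) bs) (drop (length (Q j E)) bs) = Ask qs"
        using Suc.prems by simp
      then show ?thesis by (rule Suc.IH)
    qed
  qed simp
  then show ?thesis unfolding valid_algorithm_def serial_alg_def by blast
qed

lemma erasure_answer_simps: "erasure_answer True b = Some b" "erasure_answer False b = None"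
  by (simp_all add: erasure_answer_def)

lemma heads_mono: "s \<le> t \<Longrightarrow> heads \<omega> s \<le> heads \<omega> t"
  unfolding heads_def by (intro card_mono) auto

lemma waiting_eq: "heads \<omega> T < K \<Longrightarrow> waiting K T \<omega> = T"
proof -
  assume "heads \<omega> T < K"
  then have "heads \<omega> t < K" if "t < T" for t using heads_mono[of t T \<omega>] that by simp
  then have "{t. t < T \<and> heads \<omega> t < K} = {..<T}" by auto
  then show ?thesis by (simp add: waiting_def)
qed

text \<open>Each head answers one more query of the transcript and each tail repeats a query, so the
  run is the process of waiting for \<open>length tr\<close> heads.\<close>

lemma serial_alg_history:
  fixes Q :: scheme and R :: nat and out :: "nat rel \<Rightarrow> 'o" and \<sigma> :: "nat \<Rightarrow> nat"
  defines "A \<equiv> serial_alg Q R out" and "tr \<equiv> transcript Q \<sigma> 0 R"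
  shows "map the (filter (\<lambda>a. a \<noteq> None) (concat (history erasure_answer A \<sigma> \<omega> k))) = map (truth \<sigma>) (take (heads \<omega> k) tr)
    \<and> length (concat (history erasure_answer A \<sigma> \<omega> k)) = waiting (length tr) k \<omega>"
proof (induction k)
  case 0
  then show ?case by simp
next
  case (Suc k)
  let ?h = "history erasure_answer A \<sigma> \<omega> k"
  have A: "A ?h = (if heads \<omega> k < length tr then Ask [tr ! heads \<omega> k] else Output (out (noiseless Q \<sigma> R)))"
  proof -
    have "A ?h = serial Q out R 0 {} (map (truth \<sigma>) (take (heads \<omega> k) tr))"
      using Suc by (subst A_def, subst serial_alg_def) (simp only:)
    then show ?thesis
      using serial_transcript[of Q out R 0 \<sigma> "heads \<omega> k"] by (simp only: noiseless.simps(1) add_0 tr_def)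
  qed
  show ?case
  proof (cases "heads \<omega> k < length tr")
    case True
    then have *: "A ?h = Ask [tr ! heads \<omega> k]" by (simp add: A)
    \<comment> \<open>While the transcript is unfinished, every round has asked one query, so round
      \<open>k\<close> consumes bit \<open>k\<close>, the next one that \<open>heads\<close>
      counts.\<close>
    have len: "length (concat ?h) = k" using Suc waiting_eq[OF True] by simp
    show ?thesis
      unfolding history_Suc_Ask[of A erasure_answer \<sigma>, OF *] len using True Suc
      by (cases "\<omega> k") (auto simp: erasure_answer_simps heads_Suc waiting_Suc take_Suc_conv_app_nth)
  next
    case False
    then have "history erasure_answer A \<sigma> \<omega> (Suc k) = ?h"
      by (intro history_Suc_Output) (simp add: A)
    then show ?thesis using Suc False by (auto simp: heads_Suc waiting_Suc)
  qed
qed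

lemma serial_alg_outputs:
  assumes "heads \<omega> k \<ge> length (transcript Q \<sigma> 0 R)"
  shows "outputs erasure_answer (serial_alg Q R out) \<sigma> \<omega> (out (noiseless Q \<sigma> R))"
proof -
  have "serial_alg Q R out (history erasure_answer (serial_alg Q R out) \<sigma> \<omega> k) =
      serial Q out R 0 {} (map (truth \<sigma>) (take (heads \<omega> k) (transcript Q \<sigma> 0 R)))"
    using serial_alg_history[of Q R out \<sigma> \<omega> k] by (subst serial_alg_def) (simp only:)
  also have "\<dots> = Output (out (noiseless Q \<sigma> R))"
    using serial_transcript[of Q out R 0 \<sigma> "heads \<omega> k"] assms by simp
  finally show ?thesis by (auto simp: outputs_def)
qed

lemma num_queries_serial_alg:
  "num_queries erasure_answer (serial_alg Q R out) \<sigma> \<omega> = (SUP k. of_nat (waiting (length (transcript Q \<sigma> 0 R)) k \<omega>))"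
  by (simp add: num_queries_def serial_alg_history)

lemma expectation_waiting_SUP_le:
  assumes p: "0 < p" "p \<le> 1"
  shows "(\<integral>\<^sup>+\<omega>. (SUP k. of_nat (waiting K k \<omega>)) \<partial>noise p) \<le> ennreal (K / p)"
proof -
  have "incseq (\<lambda>k \<omega>. of_nat (waiting K k \<omega>) :: ennreal)"
    by (intro incseq_SucI) (auto simp: le_fun_def waiting_Suc)
  then have "(\<integral>\<^sup>+\<omega>. (SUP k. of_nat (waiting K k \<omega>)) \<partial>noise p) = (SUP k. \<integral>\<^sup>+\<omega>. of_nat (waiting K k \<omega>) \<partial>noise p)"
    by (intro nn_integral_monotone_convergence_SUP) auto
  also have "\<dots> \<le> ennreal (K / p)"
    by (intro SUP_least expectation_waiting_le p)
  finally show ?thesis .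
qed

text \<open>Fewer than \<open>K\<close> heads forever would make the waiting time infinite, although
  its mean is at most \<open>K / p\<close>.\<close>

lemma AE_heads_unbounded:
  assumes p: "0 < p" "p \<le> 1"
  shows "AE \<omega> in noise p. \<exists>k. heads \<omega> k \<ge> K"
proof -
  have "(\<integral>\<^sup>+\<omega>. (SUP k. of_nat (waiting K k \<omega>)) \<partial>noise p) \<noteq> \<infinity>"
    using expectation_waiting_SUP_le[OF p, of K] by (auto simp: top_unique)
  then have "AE \<omega> in noise p. (SUP k. of_nat (waiting K k \<omega>) :: ennreal) \<noteq> \<infinity>"
    by (intro nn_integral_noteq_infinite) auto
  then show ?thesis
  proof eventually_elim
    case (elim \<omega>)
    show ?case
    proof (rule ccontr)
      assume "\<not> (\<exists>k. heads \<omega> k \<ge> K)"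
      then have "waiting K k \<omega> = k" for k by (intro waiting_eq) (auto simp: not_le)
      then show False using elim by (simp add: ennreal_SUP_of_nat_eq_top)
    qed
  qed
qed

lemma success_prob_serial_alg:
  assumes p: "0 < p" "p \<le> 1"
    and corr: "\<And>\<sigma>. \<sigma> \<in> rankings n \<Longrightarrow> correct n \<sigma> (out (noiseless Q \<sigma> R))"
  shows "success_prob n p erasure_answer correct (serial_alg Q R out) = 1"
proof -
  interpret N: prob_space "noise p" by (rule prob_space_noise)
  interpret S: prob_space "run_space n p" by (rule prob_space_run_space)
  define A where "A = serial_alg Q R out"
  define B where "B = {x \<in> rankings n \<times> UNIV. \<exists>y. outputs erasure_answer A (fst x) (snd x) y \<and> correct n (fst x) y}"
  \<comment> \<open>The maximum over the finitely many orders makes the noise event \<open>N\<close>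
    common to all of them.\<close>
  define K where "K = Max ((\<lambda>\<sigma>. length (transcript Q \<sigma> 0 R)) ` rankings n)"
  define N where "N = {\<omega>. \<exists>k. heads \<omega> k \<ge> K}"
  have N: "N \<in> sets (noise p)"
  proof -
    have "{\<omega>. heads \<omega> k \<ge> K} \<in> sets (noise p)" for k
      by (rule sets_noise_finite_dep[of k]) (use heads_cong in metis)
    moreover have "N = (\<Union>k. {\<omega>. heads \<omega> k \<ge> K})" by (auto simp: N_def)
    ultimately show ?thesis by auto
  qed
  have "AE \<omega> in noise p. \<omega> \<notin> UNIV - N" using AE_heads_unbounded[OF p, of K] by (simp add: N_def)
  then have N1: "measure (noise p) (UNIV - N) = 0"
    using N by (intro N.prob_eq_0[THEN iffD2]) (auto intro: sets.Diff simp: sets.top[of "noise p", simplified])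
  have B: "B \<in> sets (run_space n p)"
  proof -
    \<comment> \<open>An output may come arbitrarily late, so the success event is a countable union
      of events determined by the first \<open>k\<close> bits.\<close>
    define P where "P k \<sigma> \<omega> \<longleftrightarrow> (\<exists>y. A (history erasure_answer A \<sigma> \<omega> k) = Output y \<and> correct n \<sigma> y)" for k \<sigma> \<omega>
    have "{x \<in> rankings n \<times> UNIV. P k (fst x) (snd x)} \<in> sets (run_space n p)" for k
    proof (rule sets_run_space_finite_dep[of n k])
      fix \<sigma> and \<omega> \<omega>' :: "nat \<Rightarrow> bool" assume *: "\<And>i. i < k \<Longrightarrow> \<omega> i = \<omega>' i"
      have "length (concat (history erasure_answer A \<sigma> \<omega> k)) \<le> k"
      proof -
        have "card {t. t < k \<and> heads \<omega> t < length (transcript Q \<sigma> 0 R)} \<le> card {..<k}"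
          by (intro card_mono) auto
        then show ?thesis using serial_alg_history[of Q R out \<sigma> \<omega> k] by (simp add: A_def waiting_def)
      qed
      then have "history erasure_answer A \<sigma> \<omega>' k = history erasure_answer A \<sigma> \<omega> k"
        using * by (rule history_finite_dep)
      then show "P k \<sigma> \<omega> = P k \<sigma> \<omega>'" by (simp add: P_def)
    qed
    moreover have "B = (\<Union>k. {x \<in> rankings n \<times> UNIV. P k (fst x) (snd x)})"
      by (auto simp: B_def P_def outputs_def)
    ultimately show ?thesis by auto
  qed
  have "rankings n \<times> N \<subseteq> B"
  proof safe
    fix \<sigma> \<omega> assume \<sigma>: "\<sigma> \<in> rankings n" and \<omega>: "\<omega> \<in> N"
    have "length (transcript Q \<sigma> 0 R) \<le> K" unfolding K_def using \<sigma> by (intro Max_ge) auto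
    moreover obtain k where "heads \<omega> k \<ge> K" using \<omega> by (auto simp: N_def)
    ultimately have "outputs erasure_answer A \<sigma> \<omega> (out (noiseless Q \<sigma> R))"
      unfolding A_def by (intro serial_alg_outputs[where k = k]) simp
    then show "(\<sigma>, \<omega>) \<in> B" using \<sigma> corr by (auto simp: B_def)
  qed
  then have "measure (run_space n p) B \<ge> 1"
    using prob_run_space_ge[OF B order_refl N] N1 by simp
  moreover have "measure (run_space n p) B = success_prob n p erasure_answer correct A"
    unfolding success_prob_def B_def by (intro arg_cong[where f = "measure _"]) (auto simp: space_run_space)
  ultimately show ?thesis using S.prob_le_1[of B] by (simp add: A_def)
qed

text \<open>By Fubini the order can be fixed first; then the cost is the waiting time for as many
  heads as the transcript has queries, and the transcript does not depend on the noise.\<close>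

lemma expected_queries_serial_alg:
  assumes p: "0 < p" "p \<le> 1"
  shows "expected_queries n p erasure_answer (serial_alg Q R out) \<le>
    ennreal ((\<Sum>\<sigma>\<in>rankings n. real (length (transcript Q \<sigma> 0 R))) / fact n / p)"
proof -
  interpret N: prob_space "noise p" by (rule prob_space_noise)
  define L where "L \<sigma> = length (transcript Q \<sigma> 0 R)" for \<sigma>
  have m: "(\<lambda>x. (SUP k. of_nat (waiting (L (fst x)) k (snd x)) :: ennreal)) \<in> borel_measurable (uniform_count_measure (rankings n) \<Otimes>\<^sub>M noise p)"
  proof (intro borel_measurable_SUP)
    fix k
    have "(\<lambda>x. waiting (L (fst x)) k (snd x)) \<in> measurable (run_space n p) (count_space UNIV)"
    proof (rule measurableI)
      fix A :: "nat set"
      have "{x \<in> rankings n \<times> UNIV. waiting (L (fst x)) k (snd x) \<in> A} \<in> sets (run_space n p)"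
        by (rule sets_run_space_finite_dep[of n k]) (use waiting_cong in metis)
      also have "{x \<in> rankings n \<times> UNIV. waiting (L (fst x)) k (snd x) \<in> A} =
        (\<lambda>x. waiting (L (fst x)) k (snd x)) -` A \<inter> space (run_space n p)" by (auto simp: space_run_space)
      finally show "(\<lambda>x. waiting (L (fst x)) k (snd x)) -` A \<inter> space (run_space n p) \<in> sets (run_space n p)" .
    qed auto
    then show "(\<lambda>x. of_nat (waiting (L (fst x)) k (snd x)) :: ennreal) \<in> borel_measurable (uniform_count_measure (rankings n) \<Otimes>\<^sub>M noise p)"
      unfolding run_space_eq by measurable
  qed auto
  have "expected_queries n p erasure_answer (serial_alg Q R out) =
     (\<integral>\<^sup>+x. (SUP k. of_nat (waiting (L (fst x)) k (snd x))) \<partial>(uniform_count_measure (rankings n) \<Otimes>\<^sub>M noise p))"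
    unfolding expected_queries_def run_space_eq num_queries_serial_alg L_def by (simp add: split_beta')
  also have "\<dots> = (\<integral>\<^sup>+\<sigma>. \<integral>\<^sup>+\<omega>. (SUP k. of_nat (waiting (L \<sigma>) k \<omega>)) \<partial>noise p \<partial>uniform_count_measure (rankings n))"
    using N.nn_integral_fst[OF m] by simp
  also have "\<dots> \<le> (\<integral>\<^sup>+\<sigma>. ennreal (L \<sigma> / p) \<partial>uniform_count_measure (rankings n))"
    by (intro nn_integral_mono expectation_waiting_SUP_le p)
  also have "\<dots> = (\<Sum>\<sigma>\<in>rankings n. ennreal (1 / fact n) * ennreal (L \<sigma> / p))"
    unfolding uniform_count_measure_def
    by (subst nn_integral_point_measure_finite) (auto simp: card_rankings)
  also have "\<dots> = ennreal (\<Sum>\<sigma>\<in>rankings n. 1 / fact n * (L \<sigma> / p))"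
    using p by (simp flip: ennreal_mult)
  also have "(\<Sum>\<sigma>\<in>rankings n. 1 / fact n * (L \<sigma> / p)) = (\<Sum>\<sigma>\<in>rankings n. real (L \<sigma>)) / fact n / p"
    by (simp add: sum_divide_distrib mult.commute)
  finally show ?thesis by (simp add: L_def)
qed

section \<open>Finding the median in four rounds\<close>

definition mid :: "nat \<Rightarrow> nat" where
  "mid n = (n - 1) div 2"

definition sound :: "(nat \<Rightarrow> nat) \<Rightarrow> nat rel \<Rightarrow> bool" where
  "sound \<sigma> E \<longleftrightarrow> (\<forall>(x, y) \<in> E. \<sigma> x < \<sigma> y)"

definition resolved :: "nat \<Rightarrow> nat rel \<Rightarrow> nat set" where
  "resolved n E = {y. y < n \<and> (\<forall>x<n. x \<noteq> y \<longrightarrow> (x, y) \<in> E\<^sup>+ \<or> (y, x) \<in> E\<^sup>+)}"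

definition known_rank :: "nat \<Rightarrow> nat rel \<Rightarrow> nat \<Rightarrow> nat" where
  "known_rank n E y = card {x. x < n \<and> (x, y) \<in> E\<^sup>+}"

text \<open>The elements that no element of known rank separates from the median.\<close>

definition candidates :: "nat \<Rightarrow> nat rel \<Rightarrow> nat set" where
  "candidates n E = {x. x < n \<and> (\<forall>w\<in>resolved n E.
     (known_rank n E w \<le> mid n \<longrightarrow> w = x \<or> (w, x) \<in> E\<^sup>+) \<and> (mid n < known_rank n E w \<longrightarrow> (x, w) \<in> E\<^sup>+))}"

definition known_median :: "nat \<Rightarrow> nat rel \<Rightarrow> nat" where
  "known_median n E = (SOME y. y \<in> resolved n E \<and> known_rank n E y = mid n)"

definition known_upper_half :: "nat \<Rightarrow> nat rel \<Rightarrow> nat set" where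
  "known_upper_half n E = {x. x < n \<and> (known_median n E, x) \<in> E\<^sup>+}"

lemma sound_trancl: "sound \<sigma> E \<Longrightarrow> (x, y) \<in> E\<^sup>+ \<Longrightarrow> \<sigma> x < \<sigma> y"
  by (rotate_tac, induction rule: trancl_induct) (fastforce simp: sound_def)+

lemma resolved_iff:
  assumes "sound \<sigma> E" "w \<in> resolved n E" "x < n"
  shows "(w, x) \<in> E\<^sup>+ \<longleftrightarrow> \<sigma> w < \<sigma> x" "(x, w) \<in> E\<^sup>+ \<longleftrightarrow> \<sigma> x < \<sigma> w"
  using assms sound_trancl[OF assms(1), of w x] sound_trancl[OF assms(1), of x w]
  by (auto simp: resolved_def)

lemma card_ranks_less:
  assumes "\<sigma> \<in> rankings n" "y < n"
  shows "card {x. x < n \<and> \<sigma> x < \<sigma> y} = \<sigma> y"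
proof -
  have "\<sigma> y < n" using assms by (simp add: rankings_less_iff)
  then have "card {x \<in> {..<n}. \<sigma> x \<in> {..<\<sigma> y}} = card {..<\<sigma> y}"
    by (intro card_rank_in[OF assms(1)]) auto
  then show ?thesis by (simp add: conj_commute)
qed

lemma known_rank_resolved:
  assumes "\<sigma> \<in> rankings n" "sound \<sigma> E" "w \<in> resolved n E"
  shows "known_rank n E w = \<sigma> w"
proof -
  have "{x. x < n \<and> (x, w) \<in> E\<^sup>+} = {x. x < n \<and> \<sigma> x < \<sigma> w}"
    using resolved_iff(2)[OF assms(2,3)] by auto
  then show ?thesis unfolding known_rank_def
    using card_ranks_less[OF assms(1), of w] assms(3) by (simp add: resolved_def)
qed

lemma resolved_mono: "E \<subseteq> E' \<Longrightarrow> resolved n E \<subseteq> resolved n E'"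
  unfolding resolved_def by (auto dest: trancl_mono)

lemma candidates_iff:
  assumes "\<sigma> \<in> rankings n" "sound \<sigma> E"
  shows "x \<in> candidates n E \<longleftrightarrow> x < n \<and>
    (\<forall>w\<in>resolved n E. (\<sigma> w \<le> mid n \<longrightarrow> \<sigma> w \<le> \<sigma> x) \<and> (mid n < \<sigma> w \<longrightarrow> \<sigma> x < \<sigma> w))"
  using known_rank_resolved[OF assms] resolved_iff[OF assms(2)] rankings_inj[OF assms(1)]
  by (auto simp: candidates_def le_less)

text \<open>An element outside the candidates is separated from every candidate by a resolved element,
  hence its comparison with \<open>y\<close> follows by transitivity.\<close>

lemma resolved_from_candidates:
  assumes \<sigma>: "\<sigma> \<in> rankings n" and E: "sound \<sigma> E" "E \<subseteq> E'"
    and y: "y \<in> candidates n E"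
    and cmp: "\<And>x. x \<in> candidates n E \<Longrightarrow> x \<noteq> y \<Longrightarrow> (x, y) \<in> E' \<or> (y, x) \<in> E'"
  shows "y \<in> resolved n E'"
proof -
  have "(x, y) \<in> E'\<^sup>+ \<or> (y, x) \<in> E'\<^sup>+" if x: "x < n" "x \<noteq> y" for x
  proof (cases "x \<in> candidates n E")
    case True
    then show ?thesis using cmp x by blast
  next
    case False
    have yn: "y < n" using y by (simp add: candidates_def)
    from False x obtain w where w: "w \<in> resolved n E"
      and c: "\<sigma> w \<le> mid n \<and> \<sigma> x < \<sigma> w \<or> mid n < \<sigma> w \<and> \<sigma> w \<le> \<sigma> x"
      unfolding candidates_iff[OF \<sigma> E(1)] by (auto simp: not_le not_less)
    have wn: "w < n" using w by (simp add: resolved_def)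
    from c have "(x, y) \<in> E\<^sup>+ \<or> (y, x) \<in> E\<^sup>+"
    proof
      assume c: "\<sigma> w \<le> mid n \<and> \<sigma> x < \<sigma> w"
      then have "(x, w) \<in> E\<^sup>+" using resolved_iff(2)[OF E(1) w x(1)] by simp
      moreover have "w = y \<or> (w, y) \<in> E\<^sup>+"
        using y w c resolved_iff(1)[OF E(1) w yn] rankings_inj[OF \<sigma>, of w y]
        unfolding candidates_iff[OF \<sigma> E(1)] by (auto simp: le_less)
      ultimately show ?thesis by (auto intro: trancl_trans)
    next
      assume c: "mid n < \<sigma> w \<and> \<sigma> w \<le> \<sigma> x"
      then have "w = x \<or> (w, x) \<in> E\<^sup>+"
        using resolved_iff(1)[OF E(1) w x(1)] rankings_inj[OF \<sigma>, of w x] by (auto simp: le_less)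
      moreover have "(y, w) \<in> E\<^sup>+"
        using y w c resolved_iff(2)[OF E(1) w yn] unfolding candidates_iff[OF \<sigma> E(1)] by auto
      ultimately show ?thesis by (auto intro: trancl_trans)
    qed
    then show ?thesis using E(2) by (auto dest: trancl_mono)
  qed
  then show ?thesis using y by (simp add: resolved_def candidates_def)
qed

lemma median_exists:
  assumes "\<sigma> \<in> rankings n" "n \<ge> 1"
  obtains y where "y < n" "\<sigma> y = mid n"
proof -
  have "mid n \<in> \<sigma> ` {..<n}" using assms(2) unfolding rankings_image[OF assms(1)] by (auto simp: mid_def)
  then show ?thesis using that by auto
qed

lemma known_median_correct:
  assumes \<sigma>: "\<sigma> \<in> rankings n" and E: "sound \<sigma> E" and y: "y \<in> resolved n E" "\<sigma> y = mid n"
  shows "known_median n E = y"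
proof -
  have "known_median n E \<in> resolved n E \<and> known_rank n E (known_median n E) = mid n"
    unfolding known_median_def
    by (rule someI[of _ y]) (simp add: y known_rank_resolved[OF \<sigma> E y(1)])
  then show ?thesis using known_rank_resolved[OF \<sigma> E] y rankings_inj[OF \<sigma>] by metis
qed

lemma known_median_select_correct:
  assumes \<sigma>: "\<sigma> \<in> rankings n" and E: "sound \<sigma> E" and y: "y \<in> resolved n E" "\<sigma> y = mid n"
  shows "select_correct n \<sigma> (known_median n E)"
  using known_median_correct[OF assms] y by (simp add: select_correct_def is_median_def resolved_def mid_def)

lemma known_upper_half_partition_correct:
  assumes \<sigma>: "\<sigma> \<in> rankings n" and E: "sound \<sigma> E" and y: "y \<in> resolved n E" "\<sigma> y = mid n"
  shows "partition_correct n \<sigma> (known_upper_half n E)"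
proof -
  have "known_upper_half n E = {x. x < n \<and> \<sigma> y < \<sigma> x}"
    using resolved_iff(1)[OF E y(1)] by (auto simp: known_upper_half_def known_median_correct[OF assms])
  then show ?thesis using y by (auto simp: partition_correct_def is_median_def mid_def)
qed

lemma learned_truth:
  "(x, y) \<in> learned qs (map (truth \<sigma>) qs) \<longleftrightarrow> (x, y) \<in> set qs \<and> \<sigma> x < \<sigma> y \<or> (y, x) \<in> set qs \<and> \<not> \<sigma> y < \<sigma> x"
proof -
  have "set (zip qs (map (truth \<sigma>) qs)) = (\<lambda>q. (q, truth \<sigma> q)) ` set qs"
    by (simp add: zip_map2 zip_same_conv_map image_image)
  then have "learned qs (map (truth \<sigma>) qs) = (\<lambda>q. if truth \<sigma> q then q else prod.swap q) ` set qs"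
    unfolding learned_def by (simp only: image_image split_conv)
  also have "(x, y) \<in> \<dots> \<longleftrightarrow> (x, y) \<in> set qs \<and> \<sigma> x < \<sigma> y \<or> (y, x) \<in> set qs \<and> \<not> \<sigma> y < \<sigma> x"
    by (force simp: image_iff truth_def split: if_splits)
  finally show ?thesis .
qed

lemma sound_noiseless:
  assumes "\<sigma> \<in> rankings n" "valid_scheme n Q"
  shows "sound \<sigma> (noiseless Q \<sigma> k)"
proof (induction k)
  case (Suc k)
  have "\<sigma> x < \<sigma> y" if "(y, x) \<in> set (Q j E)" "\<not> \<sigma> y < \<sigma> x" for x y j E
  proof -
    have "x \<noteq> y" using assms(2) that unfolding valid_scheme_def by fastforce
    then show ?thesis using that rankings_inj[OF assms(1), of x y] by linarith
  qed
  then show ?case using Suc by (auto simp: sound_def learned_truth)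
qed (simp add: sound_def)

section \<open>The four-round scheme\<close>

definition compare_all :: "nat \<Rightarrow> nat list \<Rightarrow> nat list \<Rightarrow> (nat \<times> nat) list" where
  "compare_all n xs ys = filter (\<lambda>(x, y). x < n \<and> y < n \<and> x \<noteq> y) (List.product xs ys)"

lemma set_compare_all: "(x, y) \<in> set (compare_all n xs ys) \<longleftrightarrow> x \<in> set xs \<and> y \<in> set ys \<and> x < n \<and> y < n \<and> x \<noteq> y"
  by (auto simp: compare_all_def)

lemma length_compare_all: "length (compare_all n xs ys) \<le> length xs * length ys"
  unfolding compare_all_def by (metis length_filter_le length_product)

lemma compare_all_learned:
  assumes "\<sigma> \<in> rankings n" "(x, y) \<in> set (compare_all n xs ys)"
  shows "(x, y) \<in> learned (compare_all n xs ys) (map (truth \<sigma>) (compare_all n xs ys)) \<or>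
    (y, x) \<in> learned (compare_all n xs ys) (map (truth \<sigma>) (compare_all n xs ys))"
  using assms(2) rankings_inj[OF assms(1), of x y] by (auto simp: learned_truth)

text \<open>Evaluated after round 1, when each possible pivot has been compared with the whole
  sample, so that direct edges give the true rank within the sample.\<close>

definition sample_rank :: "nat \<Rightarrow> nat rel \<Rightarrow> nat \<Rightarrow> nat" where
  "sample_rank s E y = card {x. x < s \<and> (x, y) \<in> E}"

text \<open>Asking nothing when the budget is exceeded turns the cost bound for good orders into one
  for all orders and all relations, even inconsistent ones, as \<open>queries_bounded\<close>
  demands.\<close>

definition truncate :: "nat \<Rightarrow> 'a list \<Rightarrow> 'a list" where
  "truncate K xs = (if length xs \<le> K then xs else [])"

text \<open>The windows \<open>L\<close> and \<open>H\<close> hold the ranks in the sample \<open>{..<s}\<close> that a lower and an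
  upper pivot may have.\<close>

definition core :: "nat \<Rightarrow> nat \<Rightarrow> nat \<Rightarrow> nat \<Rightarrow> nat \<Rightarrow> nat set \<Rightarrow> nat set \<Rightarrow> scheme" where
  "core n K s p q L H j E = truncate K
     (if j = 0 then compare_all n [0..<s] [0..<p]
      else if j = 1 then compare_all n [0..<n]
        [SOME a. a < p \<and> sample_rank s E a \<in> L, SOME b. b < p \<and> sample_rank s E b \<in> H]
      else compare_all n (sorted_list_of_set (candidates n E))
        (sorted_list_of_set (candidates n E \<inter> (if j = 2 then {..<q} else UNIV))))"

text \<open>The filter in \<open>compare_all\<close> guarantees validity even if \<open>SOME\<close>
  finds no pivot and returns an arbitrary number.\<close>

lemma valid_core: "valid_scheme n (core n K s p q L H)"
  by (auto simp: valid_scheme_def core_def truncate_def set_compare_all)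

lemma length_core: "length (core n K s p q L H j E) \<le> K"
  by (simp add: core_def truncate_def)

lemma finite_candidates [simp]: "finite (candidates n E)"
  unfolding candidates_def by (rule finite_subset[of _ "{..<n}"]) auto

text \<open>\<open>rank_count \<sigma> {..<s} {..<\<sigma> a}\<close> is the rank of
  \<open>a\<close> within the sample. Suitable pivots must exist, and every possible pivot with
  sample rank in a window must be suitable, since \<open>SOME\<close> may pick any of them.
  \<open>M\<close> bounds the distance of the pivots from the median, \<open>N\<close> the number of
  elements that round 3 compares with, and \<open>D\<close> the distance from the median to the
  nearest of the first \<open>q\<close> elements on either side.\<close>

definition good_ranking :: "nat \<Rightarrow> nat \<Rightarrow> nat \<Rightarrow> nat \<Rightarrow> nat set \<Rightarrow> nat set \<Rightarrow> nat \<Rightarrow> nat \<Rightarrow> nat \<Rightarrow> (nat \<Rightarrow> nat) \<Rightarrow> bool" where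
  "good_ranking n s p q L H M N D \<sigma> \<longleftrightarrow>
     (\<exists>a<p. rank_count \<sigma> {..<s} {..<\<sigma> a} \<in> L) \<and>
     (\<exists>b<p. rank_count \<sigma> {..<s} {..<\<sigma> b} \<in> H) \<and>
     (\<forall>a<p. rank_count \<sigma> {..<s} {..<\<sigma> a} \<in> L \<longrightarrow> \<sigma> a \<le> mid n \<and> mid n \<le> \<sigma> a + M) \<and>
     (\<forall>b<p. rank_count \<sigma> {..<s} {..<\<sigma> b} \<in> H \<longrightarrow> mid n < \<sigma> b \<and> \<sigma> b \<le> mid n + M) \<and>
     rank_count \<sigma> {..<q} {mid n - M..<mid n + M} \<le> N \<and>
     (\<exists>y<q. \<sigma> y \<le> mid n \<and> mid n < \<sigma> y + D) \<and>
     (\<exists>y<q. mid n < \<sigma> y \<and> \<sigma> y \<le> mid n + D)"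

lemma card_rank_window:
  assumes "\<sigma> \<in> rankings n" and "X \<subseteq> {x. x < n \<and> \<sigma> x \<in> {l..<u}}"
  shows "card X \<le> u - l"
proof -
  have "inj_on \<sigma> X" using rankings_inj[OF assms(1)] by (simp add: inj_on_def)
  then have "card X = card (\<sigma> ` X)" by (simp add: card_image)
  also have "\<dots> \<le> card {l..<u}" using assms(2) by (intro card_mono) auto
  finally show ?thesis by simp
qed

theorem core_resolves_median:
  assumes \<sigma>: "\<sigma> \<in> rankings n" and n: "n \<ge> 1" and good: "good_ranking n s p q L H M N D \<sigma>"
    and spq: "s \<le> n" "p \<le> n" "q \<le> n"
    and K: "s * p \<le> K" "n * 2 \<le> K" "(2 * M) * N \<le> K" "(2 * D) * (2 * D) \<le> K"
  shows "\<exists>y \<in> resolved n (noiseless (core n K s p q L H) \<sigma> 4). \<sigma> y = mid n"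
proof -
  define Q where "Q = core n K s p q L H"
  define E where "E k = noiseless Q \<sigma> k" for k
  have sound: "sound \<sigma> (E k)" for k
    unfolding E_def Q_def by (intro sound_noiseless[OF \<sigma>] valid_core)
  have E_Suc: "E (Suc k) = E k \<union> learned (Q k (E k)) (map (truth \<sigma>) (Q k (E k)))" for k
    by (simp add: E_def)
  have mono: "E k \<subseteq> E (Suc k)" for k by (simp add: E_Suc)
  have trunc: "truncate K (compare_all n xs ys) = compare_all n xs ys" if "length xs * length ys \<le> K" for xs ys
    using that length_compare_all[of n xs ys] by (simp add: truncate_def)
  have known: "(x, y) \<in> E (Suc k) \<or> (y, x) \<in> E (Suc k)"
    if "Q k (E k) = compare_all n xs ys" "x \<in> set xs" "y \<in> set ys" "x < n" "y < n" "x \<noteq> y" for x y k xs ys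
    using compare_all_learned[OF \<sigma>, of x y xs ys] that by (auto simp: E_Suc set_compare_all)

  have Q0: "Q 0 (E 0) = compare_all n [0..<s] [0..<p]"
    using K by (simp add: Q_def core_def trunc)
  have rank: "sample_rank s (E 1) y = rank_count \<sigma> {..<s} {..<\<sigma> y}" if "y < p" for y
  proof -
    have "(x, y) \<in> E 1 \<longleftrightarrow> \<sigma> x < \<sigma> y" if "x < s" for x
    \<comment> \<open>Sample and possible pivots are both initial segments, so they overlap. An
      element is not compared with itself, and then both sides are false.\<close>
    proof (cases "x = y")
      case False
      then show ?thesis
        using known[OF Q0, of x y] that \<open>y < p\<close> spq sound[of 1] unfolding sound_def
        by auto
    qed (use sound[of 1] in \<open>auto simp: sound_def\<close>)
    then have "{x. x < s \<and> (x, y) \<in> E 1} = {x \<in> {..<s}. \<sigma> x \<in> {..<\<sigma> y}}" by auto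
    then show ?thesis by (simp add: sample_rank_def rank_count_def)
  qed

  define a where "a = (SOME a. a < p \<and> sample_rank s (E 1) a \<in> L)"
  define b where "b = (SOME b. b < p \<and> sample_rank s (E 1) b \<in> H)"
  have "\<exists>a. a < p \<and> sample_rank s (E 1) a \<in> L"
    using good rank by (auto simp: good_ranking_def)
  then have a': "a < p \<and> sample_rank s (E 1) a \<in> L" unfolding a_def by (rule someI_ex)
  have "\<exists>b. b < p \<and> sample_rank s (E 1) b \<in> H"
    using good rank by (auto simp: good_ranking_def)
  then have b': "b < p \<and> sample_rank s (E 1) b \<in> H" unfolding b_def by (rule someI_ex)
  have a: "\<sigma> a \<le> mid n" "mid n \<le> \<sigma> a + M" and b: "mid n < \<sigma> b" "\<sigma> b \<le> mid n + M"
    using a' b' good rank by (auto simp: good_ranking_def)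
  have ab: "a < n" "b < n" using a' b' spq by auto
  have Q1: "Q 1 (E 1) = compare_all n [0..<n] [a, b]"
    using K by (simp add: Q_def core_def a_def b_def trunc)
  have "a \<in> resolved n (E 2)" "b \<in> resolved n (E 2)"
    using known[OF Q1] ab by (auto simp: resolved_def numeral_2_eq_2 intro!: r_into_trancl)
  then have "candidates n (E 2) \<subseteq> {x. x < n \<and> \<sigma> a \<le> \<sigma> x \<and> \<sigma> x < \<sigma> b}"
    using a b by (auto simp: candidates_iff[OF \<sigma> sound])
  then have C2: "candidates n (E 2) \<subseteq> {x. x < n \<and> \<sigma> x \<in> {mid n - M..<mid n + M}}"
    using a b by fastforce
  have "card (candidates n (E 2)) \<le> (mid n + M) - (mid n - M)"
    by (rule card_rank_window[OF \<sigma> C2])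
  then have c1: "card (candidates n (E 2)) \<le> 2 * M" by simp
  have "card (candidates n (E 2) \<inter> {..<q}) \<le> rank_count \<sigma> {..<q} {mid n - M..<mid n + M}"
    unfolding rank_count_def using C2 by (intro card_mono) auto
  also have "\<dots> \<le> N" using good by (simp add: good_ranking_def)
  finally have c2: "card (candidates n (E 2) \<inter> {..<q}) \<le> N" .

  have "card (candidates n (E 2)) * card (candidates n (E 2) \<inter> {..<q}) \<le> (2 * M) * N"
    by (rule mult_le_mono[OF c1 c2])
  then have Q2: "Q 2 (E 2) = compare_all n (sorted_list_of_set (candidates n (E 2)))
      (sorted_list_of_set (candidates n (E 2) \<inter> {..<q}))"
    using K by (simp add: Q_def core_def trunc)
  \<comment> \<open>Each of the first \<open>q\<close> elements either gets resolved in round 3 or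
    lies beyond an already resolved element on its own side of the median. Either way a resolved
    element at least as close to the median takes its place.\<close>
  have sep: "\<exists>w \<in> resolved n (E 3). (\<sigma> w \<le> mid n \<and> \<sigma> y \<le> \<sigma> w) \<or> (mid n < \<sigma> w \<and> \<sigma> w \<le> \<sigma> y) \<or> w = y" if "y < q" for y
  proof (cases "y \<in> candidates n (E 2)")
    case True
    have "(x, y) \<in> E 3 \<or> (y, x) \<in> E 3" if "x \<in> candidates n (E 2)" "x \<noteq> y" for x
      using known[OF Q2, of x y] that True \<open>y < q\<close>
      by (auto simp: candidates_def eval_nat_numeral)
    then have "y \<in> resolved n (E 3)"
      using True mono[of 2] by (intro resolved_from_candidates[OF \<sigma> sound[of 2]]) (auto simp: eval_nat_numeral)
    then show ?thesis by auto
  next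
    case False
    have "y < n" using that spq by simp
    with False obtain w where "w \<in> resolved n (E 2)" "\<sigma> w \<le> mid n \<and> \<sigma> y < \<sigma> w \<or> mid n < \<sigma> w \<and> \<sigma> w \<le> \<sigma> y"
      unfolding candidates_iff[OF \<sigma> sound] by (auto simp: not_le not_less)
    moreover have "resolved n (E 2) \<subseteq> resolved n (E 3)"
      using resolved_mono[OF mono[of 2]] by (simp add: eval_nat_numeral)
    ultimately show ?thesis by (meson less_imp_le subsetD)
  qed
  obtain y1 y2 where y1: "y1 < q" "\<sigma> y1 \<le> mid n" "mid n < \<sigma> y1 + D"
    and y2: "y2 < q" "mid n < \<sigma> y2" "\<sigma> y2 \<le> mid n + D"
    using good by (auto simp: good_ranking_def)
  have C3: "candidates n (E 3) \<subseteq> {x. x < n \<and> \<sigma> x \<in> {Suc (mid n) - D..<mid n + D}}"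
  proof
    fix x assume x: "x \<in> candidates n (E 3)"
    obtain w1 where w1: "w1 \<in> resolved n (E 3)"
      and "(\<sigma> w1 \<le> mid n \<and> \<sigma> y1 \<le> \<sigma> w1) \<or> (mid n < \<sigma> w1 \<and> \<sigma> w1 \<le> \<sigma> y1) \<or> w1 = y1"
      using sep[OF y1(1)] by blast
    \<comment> \<open>The second alternative would put \<open>y1\<close> above the median.\<close>
    then have w1': "\<sigma> w1 \<le> mid n" "\<sigma> y1 \<le> \<sigma> w1" using y1(2) by auto
    obtain w2 where w2: "w2 \<in> resolved n (E 3)"
      and "(\<sigma> w2 \<le> mid n \<and> \<sigma> y2 \<le> \<sigma> w2) \<or> (mid n < \<sigma> w2 \<and> \<sigma> w2 \<le> \<sigma> y2) \<or> w2 = y2"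
      using sep[OF y2(1)] by blast
    then have w2': "mid n < \<sigma> w2" "\<sigma> w2 \<le> \<sigma> y2" using y2(2) by auto
    have "x < n" "\<sigma> w1 \<le> \<sigma> x" "\<sigma> x < \<sigma> w2"
      using x w1 w1'(1) w2 w2'(1) unfolding candidates_iff[OF \<sigma> sound] by blast+
    then have "x < n" "\<sigma> y1 \<le> \<sigma> x" "\<sigma> x < \<sigma> y2" using w1'(2) w2'(2) by linarith+
    then show "x \<in> {x. x < n \<and> \<sigma> x \<in> {Suc (mid n) - D..<mid n + D}}" using y1 y2 by auto
  qed
  have "card (candidates n (E 3)) \<le> (mid n + D) - (Suc (mid n) - D)"
    by (rule card_rank_window[OF \<sigma> C3])
  then have c3: "card (candidates n (E 3)) \<le> 2 * D" by simp
  have "card (candidates n (E 3)) * card (candidates n (E 3)) \<le> (2 * D) * (2 * D)"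
    by (rule mult_le_mono[OF c3 c3])
  then have Q3: "Q 3 (E 3) = compare_all n (sorted_list_of_set (candidates n (E 3))) (sorted_list_of_set (candidates n (E 3)))"
    using K by (simp add: Q_def core_def trunc)

  obtain y where y: "y < n" "\<sigma> y = mid n" using median_exists[OF \<sigma> n] .
  \<comment> \<open>No resolved element separates the median from its own rank, so it is a candidate
    at every stage.\<close>
  then have yc: "y \<in> candidates n (E 3)" by (simp add: candidates_iff[OF \<sigma> sound])
  have "(x, y) \<in> E 4 \<or> (y, x) \<in> E 4" if "x \<in> candidates n (E 3)" "x \<noteq> y" for x
    using known[OF Q3, of x y] that yc by (auto simp: candidates_def eval_nat_numeral)
  then have "y \<in> resolved n (E 4)"
    using yc mono[of 3] by (intro resolved_from_candidates[OF \<sigma> sound[of 3]]) (auto simp: eval_nat_numeral)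
  then show ?thesis using y by (auto simp: E_def Q_def)
qed

section \<open>Comparing all pairs: small inputs and the fallback\<close>

definition brute_force :: "nat \<Rightarrow> scheme" where
  "brute_force n j E = (if j = 0 then compare_all n [0..<n] [0..<n] else [])"

lemma valid_brute_force: "valid_scheme n (brute_force n)"
  by (auto simp: valid_scheme_def brute_force_def set_compare_all)

lemma length_brute_force: "length (brute_force n j E) \<le> n * n"
  using length_compare_all[of n "[0..<n]" "[0..<n]"] by (simp add: brute_force_def)

lemma resolved_compare_all:
  assumes "\<sigma> \<in> rankings n" "y < n"
  shows "y \<in> resolved n (E \<union> learned (compare_all n [0..<n] [0..<n]) (map (truth \<sigma>) (compare_all n [0..<n] [0..<n])))"
  using compare_all_learned[OF assms(1), of _ y "[0..<n]" "[0..<n]"] assms(2)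
  by (force simp: resolved_def set_compare_all)

lemma brute_force_resolves_median:
  assumes "\<sigma> \<in> rankings n" "n \<ge> 1"
  shows "\<exists>y \<in> resolved n (noiseless (brute_force n) \<sigma> 4). \<sigma> y = mid n"
proof -
  obtain y where y: "y < n" "\<sigma> y = mid n" using median_exists[OF assms] .
  have "y \<in> resolved n (noiseless (brute_force n) \<sigma> 1)"
    using resolved_compare_all[OF assms(1) y(1), of "{}"] by (simp add: brute_force_def)
  moreover have "noiseless (brute_force n) \<sigma> 1 \<subseteq> noiseless (brute_force n) \<sigma> 4"
    by (auto simp: eval_nat_numeral)
  ultimately show ?thesis using y resolved_mono by blast
qed

text \<open>The test uses \<open>E\<close> alone, so an algorithm can carry it out. Success becomes
  certain, and only unresolved orders pay the extra \<open>n * n\<close> queries.\<close>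

definition with_fallback :: "nat \<Rightarrow> scheme \<Rightarrow> scheme" where
  "with_fallback n Q j E =
     (if j < 4 then Q j E
      else if \<exists>y\<in>resolved n E. known_rank n E y = mid n then []
      else compare_all n [0..<n] [0..<n])"

lemma with_fallback_less: "j < 4 \<Longrightarrow> with_fallback n Q j E = Q j E"
  by (simp add: with_fallback_def)

lemma valid_with_fallback: "valid_scheme n Q \<Longrightarrow> valid_scheme n (with_fallback n Q)"
  by (auto simp: valid_scheme_def with_fallback_def set_compare_all)

lemma noiseless_with_fallback: "k \<le> 4 \<Longrightarrow> noiseless (with_fallback n Q) \<sigma> k = noiseless Q \<sigma> k"
  by (induction k) (auto simp: with_fallback_less)

lemma with_fallback_resolves_median:
  assumes \<sigma>: "\<sigma> \<in> rankings n" and n: "n \<ge> 1" and Q: "valid_scheme n Q"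
  shows "\<exists>y \<in> resolved n (noiseless (with_fallback n Q) \<sigma> 5). \<sigma> y = mid n"
proof -
  let ?E = "noiseless (with_fallback n Q) \<sigma>"
  have E: "sound \<sigma> (?E 4)" by (intro sound_noiseless[OF \<sigma>] valid_with_fallback Q)
  have S: "?E 5 = ?E 4 \<union> learned (with_fallback n Q 4 (?E 4)) (map (truth \<sigma>) (with_fallback n Q 4 (?E 4)))"
    using noiseless.simps(2)[of "with_fallback n Q" \<sigma> 4] by (simp add: eval_nat_numeral)
  show ?thesis
  proof (cases "\<exists>y\<in>resolved n (?E 4). known_rank n (?E 4) y = mid n")
    case True
    then show ?thesis using known_rank_resolved[OF \<sigma> E] resolved_mono[of "?E 4" "?E 5"] S by auto
  next
    case False
    then have F: "with_fallback n Q 4 (?E 4) = compare_all n [0..<n] [0..<n]" by (simp add: with_fallback_def)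
    obtain y where "y < n" "\<sigma> y = mid n" using median_exists[OF \<sigma> n] .
    then show ?thesis using resolved_compare_all[OF \<sigma>] unfolding S F by blast
  qed
qed

lemma length_transcript_with_fallback:
  assumes \<sigma>: "\<sigma> \<in> rankings n" and Q: "valid_scheme n Q" and K: "\<And>j E. length (Q j E) \<le> K"
  shows "length (transcript (with_fallback n Q) \<sigma> 0 5) \<le>
    4 * K + (if \<exists>y \<in> resolved n (noiseless Q \<sigma> 4). \<sigma> y = mid n then 0 else n * n)"
proof -
  let ?Q = "with_fallback n Q" and ?E = "noiseless (with_fallback n Q) \<sigma>"
  have "length (transcript ?Q \<sigma> 0 k) \<le> k * K" if "k \<le> 4" for k
    using that
  proof (induction k)
    case (Suc k)
    then show ?case using K[of k "?E k"] by (simp add: transcript_0_Suc with_fallback_less)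
  qed (simp add: transcript_def)
  from this[of 4] have "length (transcript ?Q \<sigma> 0 4) \<le> 4 * K" by simp
  moreover have "length (?Q 4 (?E 4)) \<le> (if \<exists>y \<in> resolved n (noiseless Q \<sigma> 4). \<sigma> y = mid n then 0 else n * n)"
    using length_compare_all[of n "[0..<n]" "[0..<n]"] known_rank_resolved[OF \<sigma> sound_noiseless[OF \<sigma> Q]]
    by (auto simp: with_fallback_def noiseless_with_fallback)
  moreover have "length (transcript ?Q \<sigma> 0 5) = length (transcript ?Q \<sigma> 0 4) + length (?Q 4 (?E 4))"
    using transcript_0_Suc[of ?Q \<sigma> 4] by (simp add: eval_nat_numeral)
  ultimately show ?thesis by linarith
qed

section \<open>Random orders are good\<close>

definition resolves :: "nat \<Rightarrow> scheme \<Rightarrow> (nat \<Rightarrow> nat) \<Rightarrow> bool" where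
  "resolves n Q \<sigma> \<longleftrightarrow> (\<exists>y \<in> resolved n (noiseless Q \<sigma> 4). \<sigma> y = mid n)"

text \<open>An order that avoids all events collected in \<open>BB\<close> is good. There are
  \<open>2 * n + 7\<close> of them, five single ones and two tails for each of \<open>n + 1\<close>
  thresholds, each of probability at most exp(-k/2).\<close>

lemma card_bad_rankings:
  fixes k n :: nat
  assumes k: "k \<ge> 2" "k ^ 20 \<le> n"
  defines "s \<equiv> k ^ 13" and "w \<equiv> n div k ^ 6" and "D \<equiv> n div k ^ 10"
  defines "L \<equiv> {x. s * mid n / n - 5 * k ^ 7 \<le> real x \<and> real x < s * mid n / n - k ^ 7}"
    and "H \<equiv> {x. s * mid n / n + k ^ 7 < real x \<and> real x \<le> s * mid n / n + 5 * k ^ 7}"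
  shows "real (card {\<sigma> \<in> rankings n. \<not> good_ranking n s (k ^ 7) (k ^ 11) L H (12 * w) (25 * k ^ 6) D \<sigma>})
    \<le> fact n * (9 * n * exp (- (k / 2)))"
proof -
  define p where "p = k ^ 7"
  define q where "q = k ^ 11"
  define \<mu> where "\<mu> = mid n"
  define t where "t = real k ^ 7"
  have k0: "k > 0" using k by simp
  have kpow: "(2::nat) ^ j \<le> k ^ j" for j using k by (intro power_mono) auto
  have le_n: "k ^ j \<le> n" if "j \<le> 20" for j
    using order.trans[OF power_increasing[OF that, of k] k(2)] k0 by simp
  have n: "n \<ge> 2 ^ 20" using kpow[of 20] k by simp
  have s: "s > 0" "s \<le> n" and p: "p \<le> n" and q: "q > 0" "q \<le> n"
    using k0 le_n by (auto simp: s_def p_def q_def)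
  have w_le: "w * k ^ 6 \<le> n" and w_gt: "n < (w + 1) * k ^ 6"
    using k0 by (auto simp: w_def dividend_less_times_div mult.commute)
  have D_le: "D * k ^ 10 \<le> n" and D_gt: "n < (D + 1) * k ^ 10"
    using k0 by (auto simp: D_def dividend_less_times_div mult.commute)
  have w1: "w \<ge> 1" and D1: "D \<ge> 1"
    using le_n[of 6] le_n[of 10] k0 by (auto simp: w_def D_def Suc_le_eq div_greater_zero_iff)
  have w64: "64 * w \<le> n"
  proof -
    have "w * 64 \<le> w * k ^ 6" using kpow[of 6] by (intro mult_left_mono) auto
    then show ?thesis using w_le by linarith
  qed
  have D64: "64 * D \<le> n"
  proof -
    have "D * 1024 \<le> D * k ^ 10" using kpow[of 10] by (intro mult_left_mono) auto
    then show ?thesis using D_le by linarith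
  qed
  have \<mu>: "4 * w \<le> \<mu>" "\<mu> + 4 * w + 1 \<le> n" "D \<le> \<mu>" "\<mu> + D + 1 \<le> n" "\<mu> < n"
    using w64 D64 n by (auto simp: \<mu>_def mid_def)
  have \<mu>2: "2 * \<mu> \<le> n" by (simp add: \<mu>_def mid_def)
  have n0: "real n > 0" using n by simp

  define X where "X \<sigma> r = real (rank_count \<sigma> {..<s} {..<r})" for \<sigma> r
  \<comment> \<open>The offsets leave room for a deviation of less than \<open>t\<close> in the
    sample rank. Ranks between 3 w and 4 w below the median have an expected sample rank between 2 t
    and 4 t below that of the median, hence an observed one in \<open>L\<close>. Conversely, an
    observed rank in \<open>L\<close> puts the expected one less than 6 t below that of the median,
    which means fewer than 6 v < 12 w ranks. The upper side is symmetric.\<close>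
  define I1 where "I1 = {\<mu> - 4 * w..<\<mu> - 3 * w}"
  define I2 where "I2 = {\<mu> + 3 * w + 1..<\<mu> + 4 * w + 1}"
  define I3 where "I3 = {\<mu> + 1 - D..<\<mu> + 1}"
  define I4 where "I4 = {\<mu> + 1..<\<mu> + D + 1}"
  define I5 where "I5 = {\<mu> - 12 * w..<\<mu> + 12 * w}"
  define B1 where "B1 T I = {\<sigma> \<in> rankings n. rank_count \<sigma> T I = 0}" for T I
  \<comment> \<open>The mean is at most 24 k^5. A deviation of k^6 among k^11 elements has exponent
    -2 k and keeps the count below 25 k^6.\<close>
  define B2 where "B2 = {\<sigma> \<in> rankings n. real (rank_count \<sigma> {..<q} I5) \<ge> card {..<q} * card I5 / n + k ^ 6}"
  define B3 where "B3 r = {\<sigma> \<in> rankings n. real (rank_count \<sigma> {..<s} {..<r}) \<ge> card {..<s} * card {..<r} / n + t}" for r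
  define B4 where "B4 r = {\<sigma> \<in> rankings n. real (rank_count \<sigma> {..<s} {..<r}) \<le> card {..<s} * card {..<r} / n - t}" for r
  define BB where "BB = (B1 {..<p} I1 \<union> B1 {..<p} I2 \<union> B1 {..<q} I3 \<union> B1 {..<q} I4 \<union> B2) \<union> (\<Union>r\<in>{..n}. B3 r \<union> B4 r)"
  have fin: "finite (B1 T I)" "finite B2" "finite (B3 r)" "finite (B4 r)" for T I r
    by (auto simp: B1_def B2_def B3_def B4_def)

  \<comment> \<open>The window width before rounding. A deviation of \<open>t\<close> in the sample
    rank corresponds to exactly \<open>v\<close> ranks; \<open>scale\<close> translates between the
    two.\<close>
  define v where "v = n / real (k ^ 6)"
  have v: "real w \<le> v" "v < w + 1"
  proof -
    have "real (w * k ^ 6) \<le> real n" "real n < real ((w + 1) * k ^ 6)" using w_le w_gt unfolding of_nat_le_iff of_nat_less_iff by auto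
    then show "real w \<le> v" "v < w + 1" using k0 by (auto simp: v_def field_simps)
  qed
  have v0: "v > 0" using v w1 by linarith
  have t0: "t > 0" using k0 by (simp add: t_def)
  have "real k ^ 13 = real k ^ 6 * real k ^ 7" by (simp flip: power_add)
  then have sv: "real s * x / real n = x / v * t" for x :: real
    using k0 n0 by (simp add: v_def s_def t_def field_simps)
  have scale: "real s * x / real n \<le> real s * y / real n + c * t \<longleftrightarrow> x \<le> y + c * v"
    "real s * x / real n < real s * y / real n + c * t \<longleftrightarrow> x < y + c * v" for x y c :: real
  proof -
    have "real s * y / real n + c * t = (y + c * v) / v * t"
      unfolding sv using v0 by (simp add: field_simps)
    then show "real s * x / real n \<le> real s * y / real n + c * t \<longleftrightarrow> x \<le> y + c * v"
      "real s * x / real n < real s * y / real n + c * t \<longleftrightarrow> x < y + c * v"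
      using v0 t0 by (simp_all add: sv divide_le_cancel divide_less_cancel)
  qed

  have sub: "{\<sigma> \<in> rankings n. \<not> good_ranking n s p q L H (12 * w) (25 * k ^ 6) D \<sigma>} \<subseteq> BB"
  proof (rule ccontr)
    assume "\<not> ?thesis"
    then obtain \<sigma> where \<sigma>: "\<sigma> \<in> rankings n" and notgood: "\<not> good_ranking n s p q L H (12 * w) (25 * k ^ 6) D \<sigma>"
      and notB: "\<sigma> \<notin> BB" by blast
    \<comment> \<open>The threshold is the random rank of \<open>y\<close>, and \<open>y\<close> may
      itself be sampled; the tails at all fixed \<open>r \<le> n\<close> in \<open>BB\<close> cover
      it.\<close>
    have X: "s * (\<sigma> y) / n < X \<sigma> (\<sigma> y) + t" "X \<sigma> (\<sigma> y) < s * (\<sigma> y) / n + t" if "y < n" for y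
    proof -
      have "\<sigma> y \<le> n" using that \<sigma> rankings_less_iff[of \<sigma> n y] by simp
      then have "\<sigma> \<notin> B3 (\<sigma> y)" "\<sigma> \<notin> B4 (\<sigma> y)" using notB by (auto simp: BB_def)
      then show "s * (\<sigma> y) / n < X \<sigma> (\<sigma> y) + t" "X \<sigma> (\<sigma> y) < s * (\<sigma> y) / n + t"
        using \<sigma> by (auto simp: B3_def B4_def X_def)
    qed
    have hit: "\<exists>y\<in>T. \<sigma> y \<in> I" if "\<sigma> \<notin> B1 T I" for T I
    proof (rule ccontr)
      assume "\<not> (\<exists>y\<in>T. \<sigma> y \<in> I)"
      then have "{x \<in> T. \<sigma> x \<in> I} = {}" by auto
      then have "rank_count \<sigma> T I = 0" unfolding rank_count_def by (simp only: card.empty)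
      then show False using that \<sigma> by (simp add: B1_def)
    qed
    have "\<exists>a<p. rank_count \<sigma> {..<s} {..<\<sigma> a} \<in> L"
    proof -
      obtain a where a: "a < p" "\<sigma> a \<in> I1" using hit[of "{..<p}" I1] notB by (auto simp: BB_def)
      then have "real (\<sigma> a) \<ge> \<mu> - 4 * w" "real (\<sigma> a) + 3 * w + 1 \<le> \<mu>"
        using \<mu> by (auto simp: I1_def)
      then have "real \<mu> \<le> \<sigma> a + 4 * v" "real (\<sigma> a) \<le> \<mu> + (-2) * v" using v w1 by linarith+
      then have "s * \<mu> / n \<le> s * (\<sigma> a) / n + 4 * t" "s * (\<sigma> a) / n \<le> s * \<mu> / n + (-2) * t"
        unfolding scale of_nat_mult by auto
      then show ?thesis using X[of a] a p by (intro exI[of _ a]) (auto simp: L_def X_def t_def \<mu>_def)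
    qed
    moreover have "\<exists>b<p. rank_count \<sigma> {..<s} {..<\<sigma> b} \<in> H"
    proof -
      obtain b where b: "b < p" "\<sigma> b \<in> I2" using hit[of "{..<p}" I2] notB by (auto simp: BB_def)
      then have "real (\<sigma> b) \<ge> \<mu> + 3 * w + 1" "real (\<sigma> b) \<le> \<mu> + 4 * w"
        by (auto simp: I2_def)
      then have "real \<mu> \<le> \<sigma> b + (-2) * v" "real (\<sigma> b) \<le> \<mu> + 4 * v" using v w1 by linarith+
      then have "s * \<mu> / n \<le> s * (\<sigma> b) / n + (-2) * t" "s * (\<sigma> b) / n \<le> s * \<mu> / n + 4 * t"
        unfolding scale of_nat_mult by auto
      then show ?thesis using X[of b] b p by (intro exI[of _ b]) (auto simp: H_def X_def t_def \<mu>_def)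
    qed
    moreover have "\<sigma> a \<le> mid n \<and> mid n \<le> \<sigma> a + 12 * w" if "a < p" "rank_count \<sigma> {..<s} {..<\<sigma> a} \<in> L" for a
    proof -
      have "s * (\<sigma> a) / n < s * \<mu> / n + 0 * t" "s * \<mu> / n < s * (\<sigma> a) / n + 6 * t"
        using X[of a] that p by (auto simp: L_def X_def t_def \<mu>_def)
      then have "real (\<sigma> a) < \<mu> + 0 * v" "real \<mu> < \<sigma> a + 6 * v" unfolding scale of_nat_mult by auto
      then show ?thesis using v w1 unfolding \<mu>_def by linarith
    qed
    moreover have "mid n < \<sigma> b \<and> \<sigma> b \<le> mid n + 12 * w" if "b < p" "rank_count \<sigma> {..<s} {..<\<sigma> b} \<in> H" for b
    proof -
      have "s * \<mu> / n < s * (\<sigma> b) / n + 0 * t" "s * (\<sigma> b) / n < s * \<mu> / n + 6 * t"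
        using X[of b] that p by (auto simp: H_def X_def t_def \<mu>_def)
      then have "real \<mu> < \<sigma> b + 0 * v" "real (\<sigma> b) < \<mu> + 6 * v" unfolding scale of_nat_mult by auto
      then show ?thesis using v w1 unfolding \<mu>_def by linarith
    qed
    moreover have "rank_count \<sigma> {..<q} {mid n - 12 * w..<mid n + 12 * w} \<le> 25 * k ^ 6"
    proof -
      have "real (rank_count \<sigma> {..<q} I5) < q * card I5 / n + k ^ 6"
        using notB \<sigma> by (auto simp: BB_def B2_def)
      moreover have "q * card I5 / n \<le> 24 * k ^ 5"
      proof -
        have "card I5 \<le> 24 * w" by (simp add: I5_def)
        then have "q * card I5 \<le> q * (24 * w)" by simp
        also have "\<dots> = 24 * k ^ 5 * (w * k ^ 6)" by (simp add: q_def flip: power_add)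
        also have "\<dots> \<le> 24 * k ^ 5 * n" using w_le by (intro mult_left_mono) auto
        finally have "real (q * card I5) \<le> 24 * k ^ 5 * n" by (metis of_nat_le_iff of_nat_mult of_nat_numeral of_nat_power)
        then show ?thesis using n0 by (simp add: divide_le_eq)
      qed
      moreover have "24 * real k ^ 5 \<le> 24 * k ^ 6" using k0 by (simp add: power_increasing)
      ultimately have "real (rank_count \<sigma> {..<q} I5) < real (25 * k ^ 6)" by simp
      then show ?thesis unfolding of_nat_less_iff I5_def \<mu>_def by simp
    qed
    moreover have "\<exists>y<q. \<sigma> y \<le> mid n \<and> mid n < \<sigma> y + D"
      using hit[of "{..<q}" I3] notB by (force simp: BB_def I3_def \<mu>_def)
    moreover have "\<exists>y<q. mid n < \<sigma> y \<and> \<sigma> y \<le> mid n + D"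
      using hit[of "{..<q}" I4] notB by (force simp: BB_def I4_def \<mu>_def)
    ultimately show False using notgood unfolding good_ranking_def by blast
  qed

  define e where "e = exp (- (real k / 2))"
  \<comment> \<open>Rounding down loses at most a factor 2, so the expected number of hits is at
    least k / 2. This is the origin of exp(-k/2).\<close>
  have half: "real k / 2 \<le> real (k ^ (j + 1) * (n div k ^ j)) / n" if "j \<le> 20" for j
  proof -
    have "n < k ^ j * (n div k ^ j) + k ^ j" using dividend_less_times_div[of "k ^ j" n] k0 by (simp add: add.commute)
    moreover have "k ^ j \<le> k ^ j * (n div k ^ j)" using le_n[OF that] k0 by (simp add: Suc_le_eq div_greater_zero_iff)
    ultimately have "n \<le> 2 * (k ^ j * (n div k ^ j))" by linarith
    then have "k * n \<le> k * (2 * (k ^ j * (n div k ^ j)))" by (rule mult_left_mono) simp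
    also have "\<dots> = 2 * (k ^ (j + 1) * (n div k ^ j))" by simp
    finally have "k * n \<le> 2 * (k ^ (j + 1) * (n div k ^ j))" .
    then have "real k * n \<le> 2 * real (k ^ (j + 1) * (n div k ^ j))" by (metis of_nat_le_iff of_nat_mult of_nat_numeral)
    then show ?thesis using n0 by (simp add: field_simps)
  qed
  have gap: "real (card (B1 {..<T} I)) \<le> fact n * e"
    if "T \<le> n" "I \<subseteq> {..<n}" "real k / 2 \<le> real (T * card I) / n" for T I
  proof -
    have "real (card (B1 {..<T} I)) \<le> fact n * exp (- (card {..<T} * card I / n))"
      unfolding B1_def using that n0 by (intro rank_count_zero_tail) auto
    also have "\<dots> \<le> fact n * e" using that(3) by (simp add: e_def)
    finally show ?thesis .
  qed
  have "real (card (B1 {..<p} I1)) \<le> fact n * e" "real (card (B1 {..<p} I2)) \<le> fact n * e"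
      "real (card (B1 {..<q} I3)) \<le> fact n * e" "real (card (B1 {..<q} I4)) \<le> fact n * e"
    using p q \<mu> half[of 6] half[of 10]
    by (auto intro!: gap simp: I1_def I2_def I3_def I4_def p_def q_def w_def D_def)
  note gaps = this
  have e2: "exp (- 2 * real k) \<le> e" by (simp add: e_def)
  have "real (card B2) \<le> fact n * exp (- 2 * (real (k ^ 6))\<^sup>2 / real (card {..<q}))"
    unfolding B2_def
    by (rule rank_count_upper_tail) (use q \<mu>2 w64 k0 in \<open>auto simp: I5_def\<close>)
  also have "- 2 * (real (k ^ 6))\<^sup>2 / real (card {..<q}) = - 2 * real k"
    using k0 by (simp add: q_def field_simps eval_nat_numeral)
  also have "fact n * exp (- 2 * real k) \<le> fact n * e" using e2 by simp
  finally have B2: "real (card B2) \<le> fact n * e" .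
  have st: "- 2 * t\<^sup>2 / card {..<s} = - 2 * real k"
  proof -
    have "t\<^sup>2 / card {..<s} = k" using k0 by (simp add: s_def t_def field_simps eval_nat_numeral)
    then show ?thesis by simp
  qed
  have B34: "real (card (B3 r \<union> B4 r)) \<le> 2 * (fact n * e)" if "r \<le> n" for r
  proof -
    have "real (card (B3 r)) \<le> fact n * exp (- 2 * t\<^sup>2 / card {..<s})"
      unfolding B3_def using s t0 that by (intro rank_count_upper_tail) auto
    moreover have "real (card (B4 r)) \<le> fact n * exp (- 2 * t\<^sup>2 / card {..<s})"
      unfolding B4_def using s t0 that by (intro rank_count_lower_tail) auto
    moreover have "fact n * exp (- 2 * t\<^sup>2 / card {..<s}) \<le> fact n * e" unfolding st using e2 by simp
    moreover have "real (card (B3 r \<union> B4 r)) \<le> real (card (B3 r)) + real (card (B4 r))"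
      using card_Un_le[of "B3 r" "B4 r"] by linarith
    ultimately show ?thesis by linarith
  qed
  have "real (card (\<Union>r\<in>{..n}. B3 r \<union> B4 r)) \<le> (\<Sum>r\<le>n. real (card (B3 r \<union> B4 r)))"
    unfolding of_nat_sum[symmetric] of_nat_le_iff by (rule card_UN_le) simp
  also have "\<dots> \<le> (\<Sum>r\<le>n. 2 * (fact n * e))" using B34 by (intro sum_mono) auto
  also have "\<dots> = (n + 1) * (2 * (fact n * e))" by simp
  finally have U: "real (card (\<Union>r\<in>{..n}. B3 r \<union> B4 r)) \<le> (n + 1) * (2 * (fact n * e))" .
  have un: "real (card (A \<union> B)) \<le> real (card A) + real (card B)" for A B :: "(nat \<Rightarrow> nat) set"
    using card_Un_le[of A B] by linarith
  have "real (card {\<sigma> \<in> rankings n. \<not> good_ranking n s p q L H (12 * w) (25 * k ^ 6) D \<sigma>}) \<le> real (card BB)"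
    using sub fin by (intro of_nat_mono card_mono) (auto simp: BB_def)
  also have "\<dots> \<le> real (card (B1 {..<p} I1)) + real (card (B1 {..<p} I2)) + real (card (B1 {..<q} I3))
      + real (card (B1 {..<q} I4)) + real (card B2) + real (card (\<Union>r\<in>{..n}. B3 r \<union> B4 r))"
    unfolding BB_def by (rule order.trans[OF un add_right_mono])+ (rule order.refl)
  also have "\<dots> \<le> 5 * (fact n * e) + (n + 1) * (2 * (fact n * e))" using gaps B2 U by linarith
  also have "\<dots> = (fact n * e) * (2 * n + 7)" by (simp add: algebra_simps)
  also have "\<dots> \<le> (fact n * e) * (9 * n)" using n by (intro mult_left_mono) (auto simp: e_def)
  finally show ?thesis by (simp add: p_def q_def e_def mult_ac)
qed

text \<open>The fraction 9 n exp(-k/2) of bad orders must not exceed 1 / (2 n^d). In view of n \<le>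
  (2 k)^20 this is the inequality with \<open>m = 20 * (d + 1)\<close>.\<close>

lemma exp_beats_power:
  "\<exists>k0\<ge>2. \<forall>k\<ge>k0. 18 * (2 * real k) ^ m * exp (- (k / 2)) \<le> 1"
proof -
  have "((\<lambda>x::real. x ^ m / exp x) \<longlongrightarrow> 0) at_top" by (rule tendsto_power_div_exp_0)
  then have "((\<lambda>k. (real k / 2) ^ m / exp (real k / 2)) \<longlongrightarrow> 0) sequentially"
  proof (rule filterlim_compose)
    show "LIM k sequentially. real k / 2 :> at_top"
      using filterlim_at_top_mult_tendsto_pos[of "\<lambda>_. 1 / 2" "1 / 2" sequentially real]
      by (simp add: filterlim_real_sequentially)
  qed
  then have "\<forall>\<^sub>F k in sequentially. (real k / 2) ^ m / exp (real k / 2) < 1 / (18 * 4 ^ m)"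
    by (rule order_tendstoD) simp
  then obtain k0 where k0: "\<And>k. k \<ge> k0 \<Longrightarrow> (real k / 2) ^ m / exp (real k / 2) < 1 / (18 * 4 ^ m)"
    by (auto simp: eventually_sequentially)
  have "18 * (2 * real k) ^ m * exp (- (k / 2)) \<le> 1" if "k \<ge> k0" for k
  proof -
    have "(2 * real k) ^ m = (4 * (real k / 2)) ^ m" by simp
    also have "\<dots> = 4 ^ m * (real k / 2) ^ m" by (rule power_mult_distrib)
    finally have eq: "(2 * real k) ^ m = 4 ^ m * (real k / 2) ^ m" .
    have "18 * (2 * real k) ^ m * exp (- (k / 2)) = 18 * 4 ^ m * ((real k / 2) ^ m / exp (real k / 2))"
      unfolding eq exp_minus by (simp only: divide_inverse mult.assoc)
    also have "\<dots> \<le> 18 * 4 ^ m * (1 / (18 * 4 ^ m))" using k0[OF that] by (intro mult_left_mono) auto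
    finally show ?thesis by simp
  qed
  then show ?thesis by (intro exI[of _ "max 2 k0"]) auto
qed

text \<open>The factor 2 reserves half of the admissible error for wrong decoding in
  \<open>rounds_alg_whp\<close>.\<close>

lemma linear_scheme_exists:
  "\<exists>C. \<forall>n\<ge>1. \<exists>Q. valid_scheme n Q \<and> (\<forall>j E. length (Q j E) \<le> C * n) \<and>
     real (card {\<sigma> \<in> rankings n. \<not> resolves n Q \<sigma>}) * (2 * real n ^ d) \<le> fact n"
proof -
  obtain k0 where k0: "k0 \<ge> 2" and exp_le: "\<And>k. k \<ge> k0 \<Longrightarrow> 18 * (2 * real k) ^ (20 * (d + 1)) * exp (- (k / 2)) \<le> 1"
    using exp_beats_power by blast
  \<comment> \<open>The power 2^22 is dictated by round 4, where (2 D)^2 is at most 4 times 2^20 n;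
    the other rounds cost less. The summand \<open>k0 ^ 20\<close> pays for comparing all pairs when
    n is below it.\<close>
  define C :: nat where "C = 2 ^ 22 + k0 ^ 20"
  have "\<exists>Q. valid_scheme n Q \<and> (\<forall>j E. length (Q j E) \<le> C * n) \<and>
     real (card {\<sigma> \<in> rankings n. \<not> resolves n Q \<sigma>}) * (2 * real n ^ d) \<le> fact n" if n1: "n \<ge> 1" for n
  proof (cases "n < k0 ^ 20")
    case True
    have "length (brute_force n j E) \<le> C * n" for j E
    proof -
      have "n * n \<le> C * n" using True by (intro mult_right_mono) (auto simp: C_def)
      then show ?thesis using length_brute_force[of n j E] by linarith
    qed
    moreover have none: "{\<sigma> \<in> rankings n. \<not> resolves n (brute_force n) \<sigma>} = {}"
      using brute_force_resolves_median[OF _ n1] by (auto simp: resolves_def)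
    ultimately show ?thesis
      by (intro exI[of _ "brute_force n"]) (simp add: none valid_brute_force)
  next
    case False
    \<comment> \<open>The integer part of the 20th root of n, so that n lies between k^20 and (2
      k)^20.\<close>
    define k where "k = (GREATEST k. k ^ 20 \<le> n)"
    have bd: "y \<le> n" if "y ^ 20 \<le> n" for y
      using that self_le_power[of y 20] by (cases "y = 0") auto
    have k: "k ^ 20 \<le> n" unfolding k_def using False bd by (intro GreatestI_nat[of "\<lambda>k. k ^ 20 \<le> n" k0 n]) auto
    have kk0: "k0 \<le> k" unfolding k_def using False bd by (intro Greatest_le_nat[of "\<lambda>k. k ^ 20 \<le> n" k0 n]) auto
    have k2: "k \<ge> 2" using kk0 k0 by simp
    have "\<not> (Suc k) ^ 20 \<le> n"
    proof
      assume "Suc k ^ 20 \<le> n"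
      then have "Suc k \<le> k" unfolding k_def by (rule Greatest_le_nat) (use bd in blast)
      then show False by simp
    qed
    moreover have "(Suc k) ^ 20 \<le> (2 * k) ^ 20" using k2 by (intro power_mono) auto
    ultimately have nk: "n \<le> (2 * k) ^ 20" by linarith
    define w where "w = n div k ^ 6"
    define D where "D = n div k ^ 10"
    define L where "L = {x. k ^ 13 * mid n / n - 5 * k ^ 7 \<le> real x \<and> real x < k ^ 13 * mid n / n - k ^ 7}"
    define H where "H = {x. k ^ 13 * mid n / n + k ^ 7 < real x \<and> real x \<le> k ^ 13 * mid n / n + 5 * k ^ 7}"
    define Q where "Q = core n (C * n) (k ^ 13) (k ^ 7) (k ^ 11) L H"
    have le_n: "k ^ j \<le> n" if "j \<le> 20" for j using order.trans[OF power_increasing[OF that, of k] k] k2 by simp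
    have C: "4194304 * n \<le> C * n" by (simp add: C_def)
    have "resolves n Q \<sigma>"
      if "\<sigma> \<in> rankings n" "good_ranking n (k ^ 13) (k ^ 7) (k ^ 11) L H (12 * w) (25 * k ^ 6) D \<sigma>" for \<sigma>
      unfolding resolves_def Q_def
    proof (rule core_resolves_median[OF that(1) n1 that(2)])
      have "k ^ 13 * k ^ 7 = k ^ 20" by (simp flip: power_add)
      then show "k ^ 13 * k ^ 7 \<le> C * n" using k C by linarith
      show "n * 2 \<le> C * n" using C by linarith
      have "w * k ^ 6 \<le> n" by (simp add: w_def)
      then have "600 * (w * k ^ 6) \<le> C * n" using C by linarith
      then show "2 * (12 * w) * (25 * k ^ 6) \<le> C * n" by simp
      have "D * k ^ 10 \<le> n" by (simp add: D_def)
      then have "(D * k ^ 10) * (D * k ^ 10) \<le> n * n" by (intro mult_le_mono)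
      also have "\<dots> \<le> n * (2 * k) ^ 20" using nk by simp
      also have "n * (2 * k) ^ 20 = (2 ^ 20 * n) * k ^ 20" by (simp add: power_mult_distrib)
      finally have "(D * D) * k ^ 20 \<le> (2 ^ 20 * n) * k ^ 20" by (simp add: algebra_simps flip: power_add)
      then have "D * D \<le> 1048576 * n" using k2 by simp
      then show "2 * D * (2 * D) \<le> C * n" using C by linarith
    qed (use le_n in auto)
    then have "card {\<sigma> \<in> rankings n. \<not> resolves n Q \<sigma>} \<le>
        card {\<sigma> \<in> rankings n. \<not> good_ranking n (k ^ 13) (k ^ 7) (k ^ 11) L H (12 * w) (25 * k ^ 6) D \<sigma>}"
      by (intro card_mono) auto
    then have "real (card {\<sigma> \<in> rankings n. \<not> resolves n Q \<sigma>}) \<le> fact n * (9 * n * exp (- (k / 2)))"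
      using card_bad_rankings[OF k2 k] unfolding L_def H_def w_def D_def by simp
    then have "real (card {\<sigma> \<in> rankings n. \<not> resolves n Q \<sigma>}) * (2 * real n ^ d) \<le>
        fact n * (9 * n * exp (- (k / 2))) * (2 * real n ^ d)"
      by (intro mult_right_mono) auto
    also have "\<dots> = fact n * (18 * real n ^ (d + 1) * exp (- (k / 2)))" by simp
    also have "\<dots> \<le> fact n * (18 * (2 * real k) ^ (20 * (d + 1)) * exp (- (k / 2)))"
    proof -
      have "real n \<le> (2 * real k) ^ 20" using nk by (metis of_nat_le_iff of_nat_mult of_nat_numeral of_nat_power)
      then have "real n ^ (d + 1) \<le> ((2 * real k) ^ 20) ^ (d + 1)" by (intro power_mono) auto
      then show ?thesis by (simp only: power_mult) (intro mult_left_mono mult_right_mono, auto)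
    qed
    also have "\<dots> \<le> fact n * 1" using exp_le[OF kk0] by (intro mult_left_mono) auto
    finally show ?thesis
      by (intro exI[of _ Q]) (simp add: Q_def valid_core length_core)
  qed
  then show ?thesis by blast
qed

section \<open>The three error bounds\<close>

text \<open>Answers that arrive are correct, so a single one decides. A fully erased block decodes
  to \<open>False\<close> by default; \<open>good_block\<close> rejects it because of the case where
  the correct answer is \<open>True\<close>.\<close>

definition seen :: "bool option list \<Rightarrow> bool" where
  "seen as \<longleftrightarrow> Some True \<in> set as"

definition majority :: "bool list \<Rightarrow> bool" where
  "majority as \<longleftrightarrow> length as < 2 * length (filter id as)"

lemma block_eq_image: "{i * m..<i * m + m} = (\<lambda>l. i * m + l) ` {..<m}" for i m :: nat
proof (intro equalityI subsetI)
  fix j assume "j \<in> {i * m..<i * m + m}"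
  then show "j \<in> (\<lambda>l. i * m + l) ` {..<m}" by (intro image_eqI[of _ _ "j - i * m"]) auto
qed auto

lemma erasure_bad_block:
  assumes "0 < \<gamma>" "\<gamma> \<le> 1"
  shows "measure (noise \<gamma>) {\<omega>. \<not> good_block erasure_answer seen m \<omega> i} \<le> exp (- (\<gamma> * m))"
proof -
  have "good_block erasure_answer seen m \<omega> i \<longleftrightarrow> (\<exists>l<m. \<omega> (i * m + l))" for \<omega>
    unfolding good_block_def seen_def erasure_answer_def by (auto simp: image_iff split: if_splits)
  then have "{\<omega>. \<not> good_block erasure_answer seen m \<omega> i} = {\<omega>. \<forall>j\<in>{i * m..<i * m + m}. \<not> \<omega> j}"
    unfolding block_eq_image by auto
  then have "measure (noise \<gamma>) {\<omega>. \<not> good_block erasure_answer seen m \<omega> i} = (1 - \<gamma>) ^ m"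
    using assms by (simp add: prob_noise_all_false)
  also have "\<dots> \<le> exp (- \<gamma>) ^ m"
    using assms exp_ge_add_one_self[of "- \<gamma>"] by (intro power_mono) auto
  also have "\<dots> = exp (- (\<gamma> * m))" by (simp flip: exp_of_nat2_mult)
  finally show ?thesis .
qed

lemma noisy_bad_block:
  fixes \<gamma> :: real
  assumes "0 < \<gamma>" "\<gamma> \<le> 1" "m > 0"
  shows "measure (noise (1/2 + \<gamma>/2)) {\<omega>. \<not> good_block noisy_answer majority m \<omega> i} \<le> exp (- (\<gamma>\<^sup>2 / 2 * m))"
proof -
  interpret N: prob_space "noise (1/2 + \<gamma>/2)" by (rule prob_space_noise)
  let ?J = "{i * m..<i * m + m}"
  have cnt: "length (filter P (map (\<lambda>l. \<omega> (i * m + l)) [0..<m])) = card {j \<in> ?J. P (\<omega> j)}" for P \<omega>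
  proof -
    have "length (filter P (map (\<lambda>l. \<omega> (i * m + l)) [0..<m])) = card {l. l < m \<and> P (\<omega> (i * m + l))}"
      by (simp add: length_filter_conv_card cong: conj_cong)
    also have "\<dots> = card ((\<lambda>l. i * m + l) ` {l. l < m \<and> P (\<omega> (i * m + l))})"
      by (intro card_image[symmetric] inj_onI) simp
    also have "(\<lambda>l. i * m + l) ` {l. l < m \<and> P (\<omega> (i * m + l))} = {j \<in> ?J. P (\<omega> j)}"
      unfolding block_eq_image by auto
    finally show ?thesis .
  qed
  have "good_block noisy_answer majority m \<omega> i" if *: "m < 2 * card {j \<in> ?J. \<omega> j}" for \<omega>
    unfolding good_block_def
  proof
    fix b
    show "majority (map (\<lambda>l. noisy_answer (\<omega> (i * m + l)) b) [0..<m]) = b"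
    proof (cases b)
      case True
      then show ?thesis using * cnt[of id \<omega>] by (simp add: majority_def noisy_answer_def)
    next
      case False
      have "card {j \<in> ?J. \<omega> j} + card {j \<in> ?J. \<not> \<omega> j} = m"
      proof -
        have "card ({j \<in> ?J. \<omega> j} \<union> {j \<in> ?J. \<not> \<omega> j}) = card {j \<in> ?J. \<omega> j} + card {j \<in> ?J. \<not> \<omega> j}"
          by (intro card_Un_disjoint) auto
        moreover have "{j \<in> ?J. \<omega> j} \<union> {j \<in> ?J. \<not> \<omega> j} = ?J" by auto
        ultimately show ?thesis by simp
      qed
      then show ?thesis using False * cnt[of id "\<lambda>j. \<not> \<omega> j"]
        by (simp add: majority_def noisy_answer_def)
    qed
  qed
  then have "{\<omega>. \<not> good_block noisy_answer majority m \<omega> i} \<subseteq> {\<omega>. 2 * card {j \<in> ?J. \<omega> j} \<le> card ?J}"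
    by (auto simp: not_le[symmetric])
  moreover have "{\<omega>. 2 * card {j \<in> ?J. \<omega> j} \<le> card ?J} \<in> sets (noise (1/2 + \<gamma>/2))"
  proof (rule sets_noise_finite_dep[of "i * m + m"])
    fix \<omega> \<omega>' :: "nat \<Rightarrow> bool" assume "\<And>j. j < i * m + m \<Longrightarrow> \<omega> j = \<omega>' j"
    then have "{j \<in> ?J. \<omega> j} = {j \<in> ?J. \<omega>' j}" by auto
    then show "(2 * card {j \<in> ?J. \<omega> j} \<le> card ?J) = (2 * card {j \<in> ?J. \<omega>' j} \<le> card ?J)" by simp
  qed
  ultimately have "N.prob {\<omega>. \<not> good_block noisy_answer majority m \<omega> i} \<le> N.prob {\<omega>. 2 * card {j \<in> ?J. \<omega> j} \<le> card ?J}"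
    by (rule N.finite_measure_mono)
  also have "\<dots> \<le> exp (- (card ?J * \<gamma>\<^sup>2 / 2))"
    using assms by (intro prob_noise_majority_false) auto
  finally show ?thesis by (simp add: mult_ac)
qed

text \<open>The summand \<open>8 * C\<close> of the exponent absorbs the constant factor 8 C,
  because 8 C \<le> 2^(8 C) \<le> n^(8 C). Thus no threshold for n depending on \<open>C\<close>
  arises.\<close>

lemma power_small:
  fixes n C d :: nat
  assumes "n \<ge> 2"
  shows "4 * (real C * n) * exp (- ((d + 1 + 8 * C) * ln n)) \<le> 1 / (2 * real n ^ d)"
proof -
  have n: "real n > 0" using assms by simp
  have "8 * C \<le> 2 ^ (8 * C)" by (rule less_imp_le[OF less_exp])
  also have "\<dots> \<le> n ^ (8 * C)" using assms by (rule power_mono) simp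
  finally have "8 * real C \<le> real n ^ (8 * C)" by (metis of_nat_le_iff of_nat_mult of_nat_numeral of_nat_power)
  then have "4 * (real C * n) * (2 * real n ^ d) \<le> real n ^ (8 * C) * real n ^ (d + 1)"
    using n mult_right_mono[of "8 * real C" "real n ^ (8 * C)" "real n ^ (d + 1)"] by (simp add: mult_ac)
  also have "\<dots> = real n ^ (d + 1 + 8 * C)" by (simp add: power_add mult_ac)
  finally have le: "4 * (real C * n) * (2 * real n ^ d) \<le> real n ^ (d + 1 + 8 * C)" .
  have exp_ln: "exp (- (real N * ln n)) = 1 / real n ^ N" for N
    using n by (simp add: exp_minus exp_of_nat_mult inverse_eq_divide)
  have "real n ^ N > 0" for N using n by simp
  then show ?thesis using le n unfolding exp_ln by (simp only: divide_le_eq le_divide_eq times_divide_eq_right mult_1_right) (simp add: mult_ac)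
qed

definition repetitions :: "nat \<Rightarrow> real \<Rightarrow> nat \<Rightarrow> nat" where
  "repetitions c g n = nat \<lceil>c * ln n / g\<rceil>"

text \<open>\<open>g\<close> is the error exponent per repetition, \<gamma> for erasures and
  \<gamma>^2 / 2 for noise. The error 1 / n^d is split evenly between bad orders and wrongly decoded
  blocks.\<close>

lemma rounds_alg_whp:
  fixes ans :: "bool \<Rightarrow> bool \<Rightarrow> 'r" and out :: "nat rel \<Rightarrow> 'o"
  assumes n: "n \<ge> 1" and g: "0 < g" "g \<le> 1"
    and Q: "valid_scheme n Q" "\<And>j E. length (Q j E) \<le> C * n"
      "real (card {\<sigma> \<in> rankings n. \<not> resolves n Q \<sigma>}) * (2 * real n ^ d) \<le> fact n"
    and bad: "\<And>m i. m > 0 \<Longrightarrow> measure (noise p) {\<omega>. \<not> good_block ans dec m \<omega> i} \<le> exp (- (g * m))"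
    and corr: "\<And>\<sigma> E y. \<sigma> \<in> rankings n \<Longrightarrow> sound \<sigma> E \<Longrightarrow> y \<in> resolved n E \<Longrightarrow> \<sigma> y = mid n \<Longrightarrow> correct n \<sigma> (out E)"
  defines "c \<equiv> d + 1 + 8 * C"
  defines "A \<equiv> rounds_alg Q dec (repetitions c g n) 4 out"
  shows "valid_algorithm n A" and "success_prob n p ans correct A \<ge> 1 - 1 / real n ^ d"
    and "queries_bounded n ans A (real (4 * C * (c + 2)) * real n * ln (real n) / g)"
    and "rounds_bounded n ans A 4"
proof -
  define m where "m = repetitions c g n"
  show "valid_algorithm n A" unfolding A_def by (rule valid_rounds_alg[OF Q(1)])
  show "rounds_bounded n ans A 4" unfolding A_def by (rule rounds_alg_bounded(2)[OF Q(2)])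
  have "real m \<le> (c + 2) * ln n / g \<and> real m \<ge> c * ln n / g \<and> (n \<ge> 2 \<longrightarrow> m > 0)"
  proof (cases "n = 1")
    case True
    then show ?thesis by (simp add: m_def repetitions_def)
  next
    case False
    then have "n \<ge> 2" using n by simp
    \<comment> \<open>Rounding up adds at most 1, and 1 \<le> 2 ln n / g for n \<ge> 2; hence
      \<open>c + 2\<close> in the query bound.\<close>
    have "ln 2 \<le> ln (real n)" using \<open>n \<ge> 2\<close> by simp
    moreover have "ln (2::real) \<ge> 1 / 2" using ln2_ge_two_thirds by simp
    ultimately have l: "ln (real n) \<ge> 1 / 2" by linarith
    then have "1 \<le> 2 * ln n / g" using g by (simp add: le_divide_eq)
    moreover have x: "c * ln n / g > 0" using l g by (auto simp: c_def intro!: divide_pos_pos mult_pos_pos)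
    moreover have "real m = of_int \<lceil>c * ln n / g\<rceil>" using x by (simp add: m_def repetitions_def)
    ultimately have "real m \<le> c * ln n / g + 2 * ln n / g" "real m \<ge> c * ln n / g" by linarith+
    then show ?thesis using x by (auto simp: algebra_simps add_divide_distrib simp flip: of_nat_0_less_iff)
  qed
  then have m: "real m \<le> (c + 2) * ln n / g" "real m \<ge> c * ln n / g" "n \<ge> 2 \<longrightarrow> m > 0" by auto
  have "real (4 * (C * n * m)) \<le> real (4 * C * (c + 2)) * real n * ln (real n) / g"
    using mult_left_mono[OF m(1), of "real (4 * (C * n))"] by (simp add: mult_ac)
  then have "ennreal (real (4 * (C * n * m))) \<le> ennreal (real (4 * C * (c + 2)) * real n * ln (real n) / g)"
    by (rule ennreal_leI)
  then show "queries_bounded n ans A (real (4 * C * (c + 2)) * real n * ln (real n) / g)"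
    using rounds_alg_bounded(1)[of Q "C * n" n ans dec m 4 out, OF Q(2)]
    unfolding queries_bounded_def A_def m_def by (meson order.trans)
  show "success_prob n p ans correct A \<ge> 1 - 1 / real n ^ d"
  \<comment> \<open>For n = 1 the logarithm leaves no queries at all, and the required success
    probability is 0.\<close>
  proof (cases "n = 1")
    case True
    then show ?thesis by (simp add: success_prob_def)
  next
    case False
    then have n2: "n \<ge> 2" using n by simp
    define G where "G = {\<sigma> \<in> rankings n. resolves n Q \<sigma>}"
    have "success_prob n p ans correct A \<ge> 1 - card (rankings n - G) / fact n - real (4 * (C * n)) * exp (- (g * m))"
      unfolding A_def m_def[symmetric]
    proof (rule success_prob_rounds_alg[OF Q(2), of G, THEN order.trans[rotated]])
      fix \<sigma> assume "\<sigma> \<in> G"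
      then show "correct n \<sigma> (out (noiseless Q \<sigma> 4))"
        using corr sound_noiseless[OF _ Q(1)] by (auto simp: G_def resolves_def)
    qed (use m(3) n2 bad in \<open>auto simp: G_def\<close>)
    moreover have "real (card (rankings n - G)) / fact n \<le> 1 / (2 * real n ^ d)"
    proof -
      have "rankings n - G = {\<sigma> \<in> rankings n. \<not> resolves n Q \<sigma>}" by (auto simp: G_def)
      then show ?thesis using Q(3) n by (simp add: field_simps)
    qed
    moreover have "real (4 * (C * n)) * exp (- (g * m)) \<le> 1 / (2 * real n ^ d)"
    proof -
      have "c * ln n \<le> g * m" using m(2) g by (simp add: field_simps)
      then have "real (4 * (C * n)) * exp (- (g * m)) \<le> 4 * (real C * n) * exp (- (c * ln n))"
        by (simp add: mult_left_mono)
      then show ?thesis using power_small[OF n2, of C d] unfolding c_def by linarith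
    qed
    moreover have "1 / (2 * real n ^ d) + 1 / (2 * real n ^ d) = 1 / real n ^ d" by (simp add: field_simps)
    ultimately show ?thesis by linarith
  qed
qed

text \<open>The fallback costs at most \<open>n * n\<close> queries on a fraction of at most 1 / (2
  n) of the orders, so it adds no more than n / 2 to the mean transcript length.\<close>

lemma serial_alg_expected_linear:
  fixes out :: "nat rel \<Rightarrow> 'o"
  assumes n: "n \<ge> 1" and \<gamma>: "0 < \<gamma>" "\<gamma> \<le> 1"
    and Q: "valid_scheme n Q" "\<And>j E. length (Q j E) \<le> C * n"
      "real (card {\<sigma> \<in> rankings n. \<not> resolves n Q \<sigma>}) * (2 * real n) \<le> fact n"
    and corr: "\<And>\<sigma> E y. \<sigma> \<in> rankings n \<Longrightarrow> sound \<sigma> E \<Longrightarrow> y \<in> resolved n E \<Longrightarrow> \<sigma> y = mid n \<Longrightarrow> correct n \<sigma> (out E)"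
  defines "A \<equiv> serial_alg (with_fallback n Q) 5 out"
  shows "valid_algorithm n A" and "success_prob n \<gamma> erasure_answer correct A = 1"
    and "expected_queries n \<gamma> erasure_answer A \<le> ennreal ((4 * real C + 1) * real n / \<gamma>)"
proof -
  let ?Q = "with_fallback n Q"
  have V: "valid_scheme n ?Q" by (rule valid_with_fallback[OF Q(1)])
  show "valid_algorithm n A" unfolding A_def by (rule valid_serial_alg[OF V])
  show "success_prob n \<gamma> erasure_answer correct A = 1"
    unfolding A_def
  proof (rule success_prob_serial_alg[OF \<gamma>])
    fix \<sigma> assume \<sigma>: "\<sigma> \<in> rankings n"
    then show "correct n \<sigma> (out (noiseless ?Q \<sigma> 5))"
      using with_fallback_resolves_median[OF \<sigma> n Q(1)] sound_noiseless[OF \<sigma> V] corr by blast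
  qed
  let ?B = "{\<sigma> \<in> rankings n. \<not> resolves n Q \<sigma>}"
  have "(\<Sum>\<sigma>\<in>rankings n. real (length (transcript ?Q \<sigma> 0 5))) \<le>
      (\<Sum>\<sigma>\<in>rankings n. 4 * (real C * n) + (if resolves n Q \<sigma> then 0 else real n * n))"
  proof (rule sum_mono)
    fix \<sigma> assume \<sigma>: "\<sigma> \<in> rankings n"
    show "real (length (transcript ?Q \<sigma> 0 5)) \<le> 4 * (real C * n) + (if resolves n Q \<sigma> then 0 else real n * n)"
      using of_nat_mono[where 'a = real, OF length_transcript_with_fallback[OF \<sigma> Q(1,2), folded resolves_def]]
      by (cases "resolves n Q \<sigma>") simp_all
  qed
  also have "\<dots> = fact n * (4 * (real C * n)) + card ?B * (real n * n)"
  proof -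
    have "(\<Sum>\<sigma>\<in>rankings n. if resolves n Q \<sigma> then 0 else real n * n) = card ?B * (real n * n)"
      by (simp add: sum.If_cases Int_def)
    then show ?thesis by (simp add: sum.distrib card_rankings)
  qed
  also have "card ?B * (real n * n) \<le> fact n * n"
  proof -
    have "2 * (card ?B * (real n * n)) \<le> fact n * n"
      using mult_right_mono[OF Q(3), of "real n"] by (simp add: algebra_simps)
    moreover have "0 \<le> card ?B * (real n * n)" by simp
    ultimately show ?thesis by linarith
  qed
  finally have "(\<Sum>\<sigma>\<in>rankings n. real (length (transcript ?Q \<sigma> 0 5))) \<le> fact n * ((4 * real C + 1) * n)"
    by (simp add: algebra_simps)
  then have "(\<Sum>\<sigma>\<in>rankings n. real (length (transcript ?Q \<sigma> 0 5))) / fact n \<le> (4 * real C + 1) * n"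
    by (simp add: divide_le_eq mult.commute)
  then have "(\<Sum>\<sigma>\<in>rankings n. real (length (transcript ?Q \<sigma> 0 5))) / fact n / \<gamma> \<le> (4 * real C + 1) * n / \<gamma>"
    using \<gamma> by (intro divide_right_mono) auto
  then show "expected_queries n \<gamma> erasure_answer A \<le> ennreal ((4 * real C + 1) * real n / \<gamma>)"
    unfolding A_def using expected_queries_serial_alg[OF \<gamma>, of n ?Q 5 out] by (meson ennreal_leI order.trans)
qed

theorem corollary1:
  shows
    "(\<exists>C>0. \<forall>n\<ge>1. \<forall>\<gamma>::real. 0 < \<gamma> \<and> \<gamma> \<le> 1 \<longrightarrow>
        (\<exists>A. valid_algorithm n A
           \<and> success_prob n \<gamma> erasure_answer partition_correct A = 1
           \<and> expected_queries n \<gamma> erasure_answer A \<le> ennreal (C * real n / \<gamma>))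
      \<and> (\<exists>A. valid_algorithm n A
           \<and> success_prob n \<gamma> erasure_answer select_correct A = 1
           \<and> expected_queries n \<gamma> erasure_answer A \<le> ennreal (C * real n / \<gamma>)))
   \<and> (\<forall>d::nat. \<exists>C>0. \<forall>n\<ge>1. \<forall>\<gamma>::real. 0 < \<gamma> \<and> \<gamma> \<le> 1 \<longrightarrow>
        (\<exists>A. valid_algorithm n A
           \<and> success_prob n \<gamma> erasure_answer partition_correct A \<ge> 1 - 1 / real n ^ d
           \<and> queries_bounded n erasure_answer A (C * real n * ln (real n) / \<gamma>)
           \<and> rounds_bounded n erasure_answer A 4)
      \<and> (\<exists>A. valid_algorithm n A
           \<and> success_prob n \<gamma> erasure_answer select_correct A \<ge> 1 - 1 / real n ^ d
           \<and> queries_bounded n erasure_answer A (C * real n * ln (real n) / \<gamma>)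
           \<and> rounds_bounded n erasure_answer A 4))
   \<and> (\<forall>d::nat. \<exists>C>0. \<forall>n\<ge>1. \<forall>\<gamma>::real. 0 < \<gamma> \<and> \<gamma> \<le> 1 \<longrightarrow>
        (\<exists>A. valid_algorithm n A
           \<and> success_prob n (1/2 + \<gamma>/2) noisy_answer partition_correct A \<ge> 1 - 1 / real n ^ d
           \<and> queries_bounded n noisy_answer A (C * real n * ln (real n) / \<gamma>\<^sup>2)
           \<and> rounds_bounded n noisy_answer A 4)
      \<and> (\<exists>A. valid_algorithm n A
           \<and> success_prob n (1/2 + \<gamma>/2) noisy_answer select_correct A \<ge> 1 - 1 / real n ^ d
           \<and> queries_bounded n noisy_answer A (C * real n * ln (real n) / \<gamma>\<^sup>2)
           \<and> rounds_bounded n noisy_answer A 4))"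
  (is "?I \<and> ?II \<and> ?III")
proof (intro conjI)
  note correct = known_upper_half_partition_correct known_median_select_correct
  show ?I
  proof -
    obtain C where C: "\<And>n. n \<ge> 1 \<Longrightarrow> \<exists>Q. valid_scheme n Q \<and> (\<forall>j E. length (Q j E) \<le> C * n) \<and>
        real (card {\<sigma> \<in> rankings n. \<not> resolves n Q \<sigma>}) * (2 * real n ^ 1) \<le> fact n"
      using linear_scheme_exists by blast
    show ?thesis
    proof (intro exI[of _ "4 * real C + 1"] conjI allI impI)
      fix n :: nat and \<gamma> :: real assume n: "n \<ge> 1" and "0 < \<gamma> \<and> \<gamma> \<le> 1"
      then have \<gamma>: "0 < \<gamma>" "\<gamma> \<le> 1" by auto
      obtain Q where Q: "valid_scheme n Q" "\<And>j E. length (Q j E) \<le> C * n"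
          "real (card {\<sigma> \<in> rankings n. \<not> resolves n Q \<sigma>}) * (2 * real n) \<le> fact n"
        using C[OF n] by auto
      note alg = serial_alg_expected_linear[OF n \<gamma> Q]
      show "\<exists>A. valid_algorithm n A \<and> success_prob n \<gamma> erasure_answer partition_correct A = 1
           \<and> expected_queries n \<gamma> erasure_answer A \<le> ennreal ((4 * real C + 1) * real n / \<gamma>)"
        using alg[of partition_correct "known_upper_half n"] correct(1) by blast
      show "\<exists>A. valid_algorithm n A \<and> success_prob n \<gamma> erasure_answer select_correct A = 1
           \<and> expected_queries n \<gamma> erasure_answer A \<le> ennreal ((4 * real C + 1) * real n / \<gamma>)"
        using alg[of select_correct "known_median n"] correct(2) by blast
    qed simp
  qed
  show ?II
  proof
    fix d
    obtain C where C: "\<And>n. n \<ge> 1 \<Longrightarrow> \<exists>Q. valid_scheme n Q \<and> (\<forall>j E. length (Q j E) \<le> C * n) \<and>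
        real (card {\<sigma> \<in> rankings n. \<not> resolves n Q \<sigma>}) * (2 * real n ^ d) \<le> fact n"
      using linear_scheme_exists by blast
    \<comment> \<open>\<open>Suc C\<close> keeps the constant positive even if
      \<open>C = 0\<close>.\<close>
    define C' where "C' = real (4 * Suc C * (d + 1 + 8 * Suc C + 2))"
    show "\<exists>C>0. \<forall>n\<ge>1. \<forall>\<gamma>::real. 0 < \<gamma> \<and> \<gamma> \<le> 1 \<longrightarrow>
        (\<exists>A. valid_algorithm n A
           \<and> success_prob n \<gamma> erasure_answer partition_correct A \<ge> 1 - 1 / real n ^ d
           \<and> queries_bounded n erasure_answer A (C * real n * ln (real n) / \<gamma>)
           \<and> rounds_bounded n erasure_answer A 4)
      \<and> (\<exists>A. valid_algorithm n A
           \<and> success_prob n \<gamma> erasure_answer select_correct A \<ge> 1 - 1 / real n ^ d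
           \<and> queries_bounded n erasure_answer A (C * real n * ln (real n) / \<gamma>)
           \<and> rounds_bounded n erasure_answer A 4)"
    proof (intro exI[of _ C'] conjI allI impI)
      fix n :: nat and \<gamma> :: real assume n: "n \<ge> 1" and "0 < \<gamma> \<and> \<gamma> \<le> 1"
      then have \<gamma>: "0 < \<gamma>" "\<gamma> \<le> 1" by auto
      obtain Q where Q: "valid_scheme n Q" "\<And>j E. length (Q j E) \<le> C * n"
          "real (card {\<sigma> \<in> rankings n. \<not> resolves n Q \<sigma>}) * (2 * real n ^ d) \<le> fact n"
        using C[OF n] by auto
      have Q': "length (Q j E) \<le> Suc C * n" for j E using Q(2)[of j E] by simp
      note alg = rounds_alg_whp[OF n \<gamma> Q(1) Q' Q(3) erasure_bad_block[OF \<gamma>], folded C'_def]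
      show "\<exists>A. valid_algorithm n A
           \<and> success_prob n \<gamma> erasure_answer partition_correct A \<ge> 1 - 1 / real n ^ d
           \<and> queries_bounded n erasure_answer A (C' * real n * ln (real n) / \<gamma>)
           \<and> rounds_bounded n erasure_answer A 4"
        using alg[of partition_correct "known_upper_half n"] correct(1) by blast
      show "\<exists>A. valid_algorithm n A
           \<and> success_prob n \<gamma> erasure_answer select_correct A \<ge> 1 - 1 / real n ^ d
           \<and> queries_bounded n erasure_answer A (C' * real n * ln (real n) / \<gamma>)
           \<and> rounds_bounded n erasure_answer A 4"
        using alg[of select_correct "known_median n"] correct(2) by blast
    qed (simp add: C'_def)
  qed
  show ?III
  proof
    fix d
    obtain C where C: "\<And>n. n \<ge> 1 \<Longrightarrow> \<exists>Q. valid_scheme n Q \<and> (\<forall>j E. length (Q j E) \<le> C * n) \<and>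
        real (card {\<sigma> \<in> rankings n. \<not> resolves n Q \<sigma>}) * (2 * real n ^ d) \<le> fact n"
      using linear_scheme_exists by blast
    define C' where "C' = real (4 * Suc C * (d + 1 + 8 * Suc C + 2))"
    show "\<exists>C>0. \<forall>n\<ge>1. \<forall>\<gamma>::real. 0 < \<gamma> \<and> \<gamma> \<le> 1 \<longrightarrow>
        (\<exists>A. valid_algorithm n A
           \<and> success_prob n (1/2 + \<gamma>/2) noisy_answer partition_correct A \<ge> 1 - 1 / real n ^ d
           \<and> queries_bounded n noisy_answer A (C * real n * ln (real n) / \<gamma>\<^sup>2)
           \<and> rounds_bounded n noisy_answer A 4)
      \<and> (\<exists>A. valid_algorithm n A
           \<and> success_prob n (1/2 + \<gamma>/2) noisy_answer select_correct A \<ge> 1 - 1 / real n ^ d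
           \<and> queries_bounded n noisy_answer A (C * real n * ln (real n) / \<gamma>\<^sup>2)
           \<and> rounds_bounded n noisy_answer A 4)"
    \<comment> \<open>The factor 2 comes from the exponent \<gamma>^2 / 2 per repetition of a
      majority vote.\<close>
    proof (intro exI[of _ "2 * C'"] conjI allI impI)
      fix n :: nat and \<gamma> :: real assume n: "n \<ge> 1" and "0 < \<gamma> \<and> \<gamma> \<le> 1"
      then have \<gamma>: "0 < \<gamma>" "\<gamma> \<le> 1" by auto
      have "\<gamma>\<^sup>2 \<le> 1" using \<gamma> by (simp add: power_le_one)
      then have \<gamma>2: "0 < \<gamma>\<^sup>2 / 2" "\<gamma>\<^sup>2 / 2 \<le> 1" using \<gamma> by auto
      obtain Q where Q: "valid_scheme n Q" "\<And>j E. length (Q j E) \<le> C * n"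
          "real (card {\<sigma> \<in> rankings n. \<not> resolves n Q \<sigma>}) * (2 * real n ^ d) \<le> fact n"
        using C[OF n] by auto
      have Q': "length (Q j E) \<le> Suc C * n" for j E using Q(2)[of j E] by simp
      have eq: "C' * real n * ln (real n) / (\<gamma>\<^sup>2 / 2) = 2 * C' * real n * ln (real n) / \<gamma>\<^sup>2" by simp
      note alg = rounds_alg_whp[OF n \<gamma>2 Q(1) Q' Q(3) noisy_bad_block[OF \<gamma>], folded C'_def, unfolded eq]
      show "\<exists>A. valid_algorithm n A
           \<and> success_prob n (1/2 + \<gamma>/2) noisy_answer partition_correct A \<ge> 1 - 1 / real n ^ d
           \<and> queries_bounded n noisy_answer A (2 * C' * real n * ln (real n) / \<gamma>\<^sup>2)
           \<and> rounds_bounded n noisy_answer A 4"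
        using alg[of partition_correct "known_upper_half n"] correct(1) by blast
      show "\<exists>A. valid_algorithm n A
           \<and> success_prob n (1/2 + \<gamma>/2) noisy_answer select_correct A \<ge> 1 - 1 / real n ^ d
           \<and> queries_bounded n noisy_answer A (2 * C' * real n * ln (real n) / \<gamma>\<^sup>2)
           \<and> rounds_bounded n noisy_answer A 4"
        using alg[of select_correct "known_median n"] correct(2) by blast
    qed (simp add: C'_def)
  qed
qed

end
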